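(* Let $0<d<1/2$ and let $\{Z_n\}_{n\in\mathbb{Z}}$ be a (real-valued) second-order stationary process whose spectral density is $$f(\lambda)=f_d(\lambda)f_0(\lambda),\qquad f_d(\lambda)=\frac{1}{2\pi}\left|1-e^{i\lambda}\right|^{-2d},\quad \lambda\in(-\pi,\pi],$$ where $f_0$ is a spectral density corresponding to the covariance function $\gamma_0(n)=\int_{-\pi}^{\pi}f_0(\lambda)e^{in\lambda}\,d\lambda$. Assume that (a) $c_0:=\inf_{\lambda\in(-\pi,\pi]}f_0(\lambda)>0$; (b) $\sum_{n=-\infty}^{\infty}|\gamma_0(n)|<\infty$. Let $\rho_{k,b}$ be the canonical correlation between the blocks $(Z_1,\dots,Z_b)$ and $(Z_{k+1},\dots,Z_{k+b})$. Then: (1) Suppose $\gamma_0(n)=O(n^{-\alpha})$ as $n\to\infty$ for some $\alpha>0$. Then for any fixed small $\epsilon>0$ (with $\epsilon<1$), there exist constants $c_1,c_2>0$ such that for all positive integers $b,k',k$ satisfying $$1\le b<k'\le(1-\epsilon)k,$$ we have $$\rho_{k,b}\le c_1\left(\frac{b}{k'-b}\right)^{1-2d}+c_2\,k'k^{-\alpha}.$$ (2) Suppose $\gamma_0(n)=o(n^{-\alpha})$ as $n\to\infty$ for some $\alpha>0$. Then the conclusion of (1) holds with the second term $c_2k'k^{-\alpha}$ replaced by $c_2k'\,r(k)$, where $r(k)=o(k^{-\alpha})$ as $k\to\infty$ and $r$ does not depend on $b,k'$. (3) Suppose $\gamma_0(n)=O(e^{-cn})$ as $n\to\infty$ for some $c>0$.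 Then the conclusion of (1) holds with the second term $c_2k'k^{-\alpha}$ replaced by $c_2e^{-c_3k}$ for some constant $c_3>0$ (not depending on $b,k',k$).
   Context: A second-order stationary process $\{Z_n\}$ has covariance function $\gamma(n)=\mathrm{Cov}[Z_n,Z_0]$ and spectral density $f$ if $\gamma(n)=\int_{-\pi}^{\pi}f(\lambda)e^{in\lambda}\,d\lambda$ for all $n\in\mathbb{Z}$. Let $\Sigma_b=(\gamma(i_2-i_1))_{1\le i_1,i_2\le b}$ be the covariance matrix of $(Z_1,\dots,Z_b)$ (assumed non-singular for every $b$) and $\Sigma_{k,b}=(\gamma(i_2+k-i_1))_{1\le i_1,i_2\le b}$ the cross-covariance matrix between $(Z_1,\dots,Z_b)$ and $(Z_{k+1},\dots,Z_{k+b})$. The canonical correlation is $$\rho_{k,b}=\sup_{\mathbf{u},\mathbf{v}\in\mathbb{R}^b}\mathrm{Corr}\Big(\sum_{j=1}^b u_jZ_j,\ \sum_{j=1}^b v_jZ_{k+j}\Big)=\sup_{\mathbf{u},\mathbf{v}\in\mathbb{R}^b}\frac{\mathbf{u}^T\Sigma_{k,b}\mathbf{v}}{\sqrt{\mathbf{u}^T\Sigma_b\mathbf{u}}\sqrt{\mathbf{v}^T\Sigma_b\mathbf{v}}},$$ the supremum being over nonzero $\mathbf{u},\mathbf{v}$. *)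

theory Defs
  imports
    "HOL-Probability.Probability"
    "HOL-Library.Landau_Symbols"
    "Jordan_Normal_Form.Matrix"
begin

section \<open>Second-order stationary processes\<close>

definition covariance :: "'a measure \<Rightarrow> ('a \<Rightarrow> real) \<Rightarrow> ('a \<Rightarrow> real) \<Rightarrow> real" where
  "covariance M X Y =
     (LINT \<omega>|M. (X \<omega> - (LINT \<omega>'|M. X \<omega>')) * (Y \<omega> - (LINT \<omega>'|M. Y \<omega>')))"

definition correlation :: "'a measure \<Rightarrow> ('a \<Rightarrow> real) \<Rightarrow> ('a \<Rightarrow> real) \<Rightarrow> real" where
  "correlation M X Y =
     covariance M X Y / (sqrt (covariance M X X) * sqrt (covariance M Y Y))"

definition second_order_stationary :: "'a measure \<Rightarrow> (int \<Rightarrow> 'a \<Rightarrow> real) \<Rightarrow> bool" where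
  "second_order_stationary M Z \<longleftrightarrow>
     (\<forall>n. Z n \<in> borel_measurable M \<and> integrable M (\<lambda>\<omega>. (Z n \<omega>)\<^sup>2)) \<and>
     (\<forall>n. (LINT \<omega>|M. Z n \<omega>) = (LINT \<omega>|M. Z 0 \<omega>)) \<and>
     (\<forall>m n h. covariance M (Z (m + h)) (Z (n + h)) = covariance M (Z m) (Z n))"

definition covariance_function :: "'a measure \<Rightarrow> (int \<Rightarrow> 'a \<Rightarrow> real) \<Rightarrow> int \<Rightarrow> real" where
  "covariance_function M Z n = covariance M (Z n) (Z 0)"

section \<open>Spectral densities\<close>

text \<open>Integrability is required explicitly because the Bochner integral of a non-integrable
  function is 0. Only the values of f on the half-open interval from -pi to pi matter.\<close>

definition spectral_density :: "(real \<Rightarrow> real) \<Rightarrow> (int \<Rightarrow> real) \<Rightarrow> bool" where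
  "spectral_density f \<gamma> \<longleftrightarrow>
     (\<forall>x\<in>{-pi<..pi}. 0 \<le> f x) \<and>
     set_integrable lborel {-pi<..pi} f \<and>
     (\<forall>n. complex_of_real (\<gamma> n) =
        (LINT x:{-pi<..pi}|lborel. complex_of_real (f x) * exp (\<i> * of_int n * of_real x)))"

text \<open>At the origin the function below is infinite for positive d; since \<open>0 powr a = 0\<close>, it
  takes the value 0 there, which affects no integral.\<close>

definition fractional_density :: "real \<Rightarrow> real \<Rightarrow> real" where
  "fractional_density d x = 1 / (2 * pi) * cmod (1 - exp (\<i> * of_real x)) powr (- 2 * d)"

section \<open>Canonical correlation of blocks\<close>

text \<open>Matrices and vectors are indexed from 0, so that entry i corresponds to index i + 1 in the
  usual numbering of the block from 1 to b.\<close>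

definition block_covariance_matrix :: "(int \<Rightarrow> real) \<Rightarrow> nat \<Rightarrow> real Matrix.mat" where
  "block_covariance_matrix \<gamma> b = Matrix.mat b b (\<lambda>(i, j). \<gamma> (int j - int i))"

text \<open>\<open>block_combination Z k u\<close> is the linear combination, with coefficients u, of the block of
  length \<open>dim_vec u\<close> that starts at time k + 1.\<close>

definition block_combination :: "(int \<Rightarrow> 'a \<Rightarrow> real) \<Rightarrow> nat \<Rightarrow> real Matrix.vec \<Rightarrow> 'a \<Rightarrow> real" where
  "block_combination Z k u = (\<lambda>\<omega>. \<Sum>j<dim_vec u. vec_index u j * Z (int k + int j + 1) \<omega>)"

definition canonical_correlation :: "'a measure \<Rightarrow> (int \<Rightarrow> 'a \<Rightarrow> real) \<Rightarrow> nat \<Rightarrow> nat \<Rightarrow> real" where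
  "canonical_correlation M Z k b =
     Sup {correlation M (block_combination Z 0 u) (block_combination Z k v) | u v.
            u \<in> carrier_vec b \<and> v \<in> carrier_vec b \<and> u \<noteq> 0\<^sub>v b \<and> v \<noteq> 0\<^sub>v b}"

end

theory Submission
  imports Defs "HOL-Real_Asymp.Real_Asymp"
begin

text \<open>
  Let h be the fractional density and g its covariance function. Integration by parts gives a
  two-term recurrence for g, which identifies \<open>g n\<close> with a multiple of
  \<open>Beta (n + d) (1 - 2 d)\<close>, hence with the integral of \<open>r powr (n + d - 1) * (1 - r) powr (- 2 d)\<close>
  over \<open>0 \<le> r \<le> 1\<close>. Under this integral the cross-covariance form of two blocks at lag \<open>j > b\<close>
  factors into values at r of the polynomials with coefficients u and v. Each such value is an integral
  of the trigonometric polynomial against a truncated geometric kernel, so Cauchy--Schwarz with the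
  weights h and \<open>1 / h\<close> bounds its square by \<open>b powr (1 - 2 d)\<close> times the variance form of g.
  The remaining Beta integral decays like \<open>(j - b) powr (2 d - 1)\<close>, which gives the theorem for the
  fractional process itself.

  In general the covariance function of Z is \<open>1 / (2 \<pi>)\<close> times the convolution of \<open>\<gamma>\<^sub>0\<close> and g, so that the form
  at lag k is a mixture of fractional forms at lags \<open>k + m\<close> with weights \<open>\<gamma>\<^sub>0 m\<close>. Lags of modulus at
  least \<open>k'\<close> contribute the first term, because \<open>\<gamma>\<^sub>0\<close> is absolutely summable. There are fewer than
  \<open>2 k'\<close> other lags; they are bounded by Cauchy--Schwarz, and \<open>\<bar>m\<bar> > k - k' \<ge> \<epsilon> k\<close> there. The lower bound
  on \<open>f\<^sub>0\<close> compares the variance forms of g with those of Z.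
\<close>

section \<open>Toeplitz forms of spectral densities\<close>

abbreviation circle_measure :: "real measure" where
  "circle_measure \<equiv> restrict_space lborel {-pi<..pi}"

definition trig_poly :: "nat \<Rightarrow> (nat \<Rightarrow> real) \<Rightarrow> real \<Rightarrow> complex" where
  "trig_poly b u x = (\<Sum>i<b. of_real (u i) * cis (real i * x))"

text \<open>For a covariance function this is the covariance between a combination \<open>u\<close>
  of one block and a combination \<open>v\<close> of the block \<open>j\<close> steps later. The lag
  is an integer because convolution shifts it to either side of zero.\<close>

definition toeplitz_form ::
    "(int \<Rightarrow> real) \<Rightarrow> nat \<Rightarrow> (nat \<Rightarrow> real) \<Rightarrow> (nat \<Rightarrow> real) \<Rightarrow> int \<Rightarrow> real" where
  "toeplitz_form \<gamma> b u v j = (\<Sum>i<b. \<Sum>l<b. u i * v l * \<gamma> (int i - int l - j))"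

lemma integral_Cauchy_Schwarz:
  fixes F G :: "'a \<Rightarrow> real"
  assumes [measurable]: "F \<in> borel_measurable M" "G \<in> borel_measurable M"
    and F: "integrable M (\<lambda>x. (F x)\<^sup>2)" and G: "integrable M (\<lambda>x. (G x)\<^sup>2)"
  shows "integrable M (\<lambda>x. F x * G x)"
    and "(LINT x|M. F x * G x)\<^sup>2 \<le> (LINT x|M. (F x)\<^sup>2) * (LINT x|M. (G x)\<^sup>2)"
proof -
  show FG: "integrable M (\<lambda>x. F x * G x)"
  proof (rule Bochner_Integration.integrable_bound)
    show "integrable M (\<lambda>x. (F x)\<^sup>2 + (G x)\<^sup>2)" using F G by simp
    show "AE x in M. norm (F x * G x) \<le> norm ((F x)\<^sup>2 + (G x)\<^sup>2)"
    proof (rule AE_I2)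
      fix x
      have "2 * (\<bar>F x\<bar> * \<bar>G x\<bar>) \<le> (F x)\<^sup>2 + (G x)\<^sup>2"
        using sum_squares_bound[of "\<bar>F x\<bar>" "\<bar>G x\<bar>"] by simp
      moreover have "0 \<le> \<bar>F x\<bar> * \<bar>G x\<bar>" by simp
      ultimately have "\<bar>F x\<bar> * \<bar>G x\<bar> \<le> (F x)\<^sup>2 + (G x)\<^sup>2" by linarith
      then show "norm (F x * G x) \<le> norm ((F x)\<^sup>2 + (G x)\<^sup>2)"
        by (simp add: abs_mult)
    qed
  qed simp
  define A B C where "A = (LINT x|M. (F x)\<^sup>2)" and "B = (LINT x|M. (G x)\<^sup>2)"
    and "C = (LINT x|M. F x * G x)"
  have quad: "0 \<le> s\<^sup>2 * A + 2 * s * t * C + t\<^sup>2 * B" for s t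
  proof -
    have "0 \<le> (LINT x|M. (s * F x + t * G x)\<^sup>2)" by simp
    also have "\<dots> = (LINT x|M. s\<^sup>2 * (F x)\<^sup>2 + 2 * s * t * (F x * G x) + t\<^sup>2 * (G x)\<^sup>2)"
      by (simp add: power2_eq_square algebra_simps)
    also have "\<dots> = s\<^sup>2 * A + 2 * s * t * C + t\<^sup>2 * B"
      using F G FG by (simp add: A_def B_def C_def)
    finally show ?thesis .
  qed
  have nn: "0 \<le> A" "0 \<le> B" by (simp_all add: A_def B_def)
  show "C\<^sup>2 \<le> A * B"
  proof (cases "A = 0 \<and> B = 0")
    case True
    then show ?thesis using quad[of 1 1] quad[of 1 "-1"] by simp
  next
    case False
    have "0 \<le> B * (A * B - C\<^sup>2)" using quad[of B "-C"]
      by (simp add: power2_eq_square algebra_simps)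
    moreover have "0 \<le> A * (A * B - C\<^sup>2)" using quad[of "-C" A]
      by (simp add: power2_eq_square algebra_simps)
    ultimately show ?thesis using False nn by (auto simp: zero_le_mult_iff)
  qed
qed

section \<open>Integration over the circle against a spectral density\<close>

lemma borel_measurable_circle: "f \<in> borel_measurable borel \<Longrightarrow> f \<in> borel_measurable circle_measure"
  by (simp add: measurable_restrict_space1)

lemma space_circle: "space circle_measure = {-pi<..pi}"
  by (simp add: space_restrict_space)

lemma finite_measure_circle: "finite_measure circle_measure"
  by (intro finite_measureI) (simp add: space_restrict_space emeasure_restrict_space)

lemma integrable_circle_mult_bounded:
  fixes f :: "real \<Rightarrow> real" and q :: "real \<Rightarrow> complex"
  assumes f: "integrable circle_measure f" and q: "q \<in> borel_measurable borel"
    and bd: "\<And>x. cmod (q x) \<le> B"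
  shows "integrable circle_measure (\<lambda>x. of_real (f x) * q x)"
proof (rule Bochner_Integration.integrable_bound)
  have [measurable]: "q \<in> borel_measurable circle_measure"
    using q by (rule borel_measurable_circle)
  note [measurable] = borel_measurable_integrable[OF f]
  show "integrable circle_measure (\<lambda>x. B * \<bar>f x\<bar>)" using f by simp
  show "(\<lambda>x. of_real (f x) * q x) \<in> borel_measurable circle_measure" by measurable
  show "AE x in circle_measure. norm (of_real (f x) * q x) \<le> norm (B * \<bar>f x\<bar>)"
  proof (rule AE_I2)
    fix x
    have "0 \<le> B" using bd[of x] norm_ge_zero[of "q x"] by linarith
    then show "norm (of_real (f x) * q x) \<le> norm (B * \<bar>f x\<bar>)"
      using mult_right_mono[OF bd[of x], of "\<bar>f x\<bar>"] by (simp add: norm_mult abs_mult mult.commute)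
  qed
qed

lemma
  assumes "spectral_density f \<gamma>"
  shows spectral_density_integrable: "integrable circle_measure f"
    and spectral_density_nonneg: "x \<in> {-pi<..pi} \<Longrightarrow> 0 \<le> f x"
    and spectral_density_coeff:
      "complex_of_real (\<gamma> n) = (LINT x|circle_measure. of_real (f x) * cis (of_int n * x))"
proof -
  show "integrable circle_measure f" and "x \<in> {-pi<..pi} \<Longrightarrow> 0 \<le> f x"
    using assms by (auto simp: spectral_density_def set_integrable_def integrable_restrict_space)
  have "complex_of_real (\<gamma> n) =
        (LINT x:{-pi<..pi}|lborel. complex_of_real (f x) * exp (\<i> * of_int n * of_real x))"
    using assms by (simp add: spectral_density_def)
  also have "\<dots> = (LINT x|circle_measure. of_real (f x) * cis (of_int n * x))"
    by (simp add: set_lebesgue_integral_def integral_restrict_space cis_conv_exp mult.assoc)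
  finally show "complex_of_real (\<gamma> n) = \<dots>" .
qed

lemma cis_mult_measurable: "(\<lambda>x. cis (c * x)) \<in> borel_measurable borel"
  by (intro borel_measurable_continuous_onI continuous_intros)

lemma spectral_density_even:
  assumes "spectral_density f \<gamma>"
  shows "\<gamma> (- n) = \<gamma> n"
proof -
  have "complex_of_real (\<gamma> (-n)) = (LINT x|circle_measure. of_real (f x) * cis (of_int (-n) * x))"
    by (rule spectral_density_coeff[OF assms])
  also have "\<dots> = (LINT x|circle_measure. cnj (of_real (f x) * cis (of_int n * x)))"
    by (simp add: cis_cnj)
  also have "\<dots> = cnj (complex_of_real (\<gamma> n))"
    unfolding spectral_density_coeff[OF assms] by (rule Bochner_Integration.integral_cnj)
  finally show ?thesis by simp
qed

lemma spectral_density_cos: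
  assumes "spectral_density f \<gamma>"
  shows "\<gamma> n = (LINT x|circle_measure. f x * cos (of_int n * x))"
proof -
  have "integrable circle_measure (\<lambda>x. of_real (f x) * cis (of_int n * x))"
    by (rule integrable_circle_mult_bounded[OF spectral_density_integrable[OF assms], of _ 1])
      (simp_all add: cis_mult_measurable)
  then have "Re (LINT x|circle_measure. of_real (f x) * cis (of_int n * x))
      = (LINT x|circle_measure. f x * cos (of_int n * x))"
    by (subst integral_Re[symmetric]) auto
  then show ?thesis using spectral_density_coeff[OF assms, of n] by (metis Re_complex_of_real)
qed

lemma trig_poly_measurable: "trig_poly b u \<in> borel_measurable borel"
  unfolding trig_poly_def[abs_def] by (intro borel_measurable_continuous_onI continuous_intros)

lemma norm_trig_poly_le: "cmod (trig_poly b u x) \<le> (\<Sum>i<b. \<bar>u i\<bar>)"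
  unfolding trig_poly_def by (rule order_trans[OF norm_sum]) (simp add: norm_mult)

text \<open>The product of the polynomials expands into exponentials of frequency
  \<open>i - l - j\<close>, and each integrates against \<open>f\<close> to the covariance at that
  index.\<close>

lemma toeplitz_form_spectral:
  assumes f: "spectral_density f \<gamma>"
  shows "complex_of_real (toeplitz_form \<gamma> b u v j) =
    (LINT x|circle_measure. of_real (f x) *
       (trig_poly b u x * cnj (trig_poly b v x) * cis (- of_int j * x)))"
proof -
  have int: "integrable circle_measure (\<lambda>x. of_real (f x) * cis (of_int n * x))" for n
    by (rule integrable_circle_mult_bounded[OF spectral_density_integrable[OF f], of _ 1])
      (simp_all add: cis_mult_measurable)
  have cc: "cis (real i * x) * cnj (cis (real l * x)) * cis (- of_int j * x)
      = cis (of_int (int i - int l - j) * x)" for i l x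
    by (simp add: cis_cnj cis_mult algebra_simps)
  have *: "of_real (f x) * (trig_poly b u x * cnj (trig_poly b v x) * cis (- of_int j * x))
     = (\<Sum>i<b. \<Sum>l<b. of_real (u i * v l) * (of_real (f x) * cis (of_int (int i - int l - j) * x)))" for x
  proof -
    have "of_real (f x) * (trig_poly b u x * cnj (trig_poly b v x) * cis (- of_int j * x))
      = (\<Sum>i<b. \<Sum>l<b. of_real (f x) * ((of_real (u i) * cis (real i * x)) *
           cnj (of_real (v l) * cis (real l * x)) * cis (- of_int j * x)))"
      unfolding trig_poly_def cnj_sum sum_product sum_distrib_left sum_distrib_right by (rule sum.swap)
    also have "\<dots> = (\<Sum>i<b. \<Sum>l<b. of_real (u i * v l) *
        (of_real (f x) * (cis (real i * x) * cnj (cis (real l * x)) * cis (- of_int j * x))))"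
      by (intro sum.cong refl) simp
    finally show ?thesis by (simp only: cc)
  qed
  have "(LINT x|circle_measure. of_real (f x) *
       (trig_poly b u x * cnj (trig_poly b v x) * cis (- of_int j * x)))
     = (\<Sum>i<b. \<Sum>l<b. of_real (u i * v l) * of_real (\<gamma> (int i - int l - j)))"
    unfolding * using int by (simp add: Bochner_Integration.integral_sum spectral_density_coeff[OF f] del: of_int_diff)
  then show ?thesis by (simp add: toeplitz_form_def)
qed

lemma toeplitz_form_diag:
  assumes f: "spectral_density f \<gamma>"
  shows "integrable circle_measure (\<lambda>x. f x * (cmod (trig_poly b u x))\<^sup>2)"
    and "toeplitz_form \<gamma> b u u 0 = (LINT x|circle_measure. f x * (cmod (trig_poly b u x))\<^sup>2)"
proof -
  have "complex_of_real (toeplitz_form \<gamma> b u u 0) =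
    (LINT x|circle_measure. complex_of_real (f x * (cmod (trig_poly b u x))\<^sup>2))"
    unfolding toeplitz_form_spectral[OF f]
    by (rule Bochner_Integration.integral_cong[OF refl])
      (simp only: of_real_mult complex_norm_square, simp)
  then have "complex_of_real (toeplitz_form \<gamma> b u u 0) =
    complex_of_real (LINT x|circle_measure. f x * (cmod (trig_poly b u x))\<^sup>2)"
    by (simp only: integral_complex_of_real)
  then show "toeplitz_form \<gamma> b u u 0 = (LINT x|circle_measure. f x * (cmod (trig_poly b u x))\<^sup>2)"
    by (simp only: of_real_eq_iff)
  have "integrable circle_measure (\<lambda>x. of_real (f x) * complex_of_real ((cmod (trig_poly b u x))\<^sup>2))"
  proof (rule integrable_circle_mult_bounded[OF spectral_density_integrable[OF f]])
    show "(\<lambda>x. complex_of_real ((cmod (trig_poly b u x))\<^sup>2)) \<in> borel_measurable borel"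
      using trig_poly_measurable[measurable] by measurable
    show "cmod (complex_of_real ((cmod (trig_poly b u x))\<^sup>2)) \<le> (\<Sum>i<b. \<bar>u i\<bar>)\<^sup>2" for x
      using power_mono[OF norm_trig_poly_le norm_ge_zero, of b u x 2] by (simp add: norm_power)
  qed
  then have "integrable circle_measure (\<lambda>x. complex_of_real (f x * (cmod (trig_poly b u x))\<^sup>2))"
    by simp
  then show "integrable circle_measure (\<lambda>x. f x * (cmod (trig_poly b u x))\<^sup>2)"
    by (simp only: complex_of_real_integrable_eq)
qed

lemma toeplitz_form_nonneg:
  assumes f: "spectral_density f \<gamma>"
  shows "0 \<le> toeplitz_form \<gamma> b u u 0"
  unfolding toeplitz_form_diag(2)[OF f]
  by (rule Bochner_Integration.integral_nonneg) (use spectral_density_nonneg[OF f] space_circle in auto)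

text \<open>The lag enters only through a factor of modulus one, so Cauchy-Schwarz with weight
  \<open>f\<close> bounds all lags alike. This serves for the lags that are too short for
  decay.\<close>

lemma toeplitz_form_le_sqrt:
  assumes f: "spectral_density f \<gamma>"
  shows "\<bar>toeplitz_form \<gamma> b u v j\<bar>
    \<le> sqrt (toeplitz_form \<gamma> b u u 0) * sqrt (toeplitz_form \<gamma> b v v 0)"
proof -
  define F where "F w x = sqrt (f x) * cmod (trig_poly b w x)" for w x
  note [measurable] = borel_measurable_integrable[OF spectral_density_integrable[OF f]]
    borel_measurable_circle[OF trig_poly_measurable]
  have Fm[measurable]: "F w \<in> borel_measurable circle_measure" for w
    unfolding F_def[abs_def] by measurable
  have fnn: "0 \<le> f x" if "x \<in> space circle_measure" for x
    using that spectral_density_nonneg[OF f] space_circle by auto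
  have F2: "(F w x)\<^sup>2 = f x * (cmod (trig_poly b w x))\<^sup>2" if "x \<in> space circle_measure" for w x
    using fnn[OF that] by (simp add: F_def power_mult_distrib)
  have F2i: "integrable circle_measure (\<lambda>x. (F w x)\<^sup>2)" for w
    using toeplitz_form_diag(1)[OF f] by (subst Bochner_Integration.integrable_cong[OF refl F2]) auto
  have F2e: "(LINT x|circle_measure. (F w x)\<^sup>2) = toeplitz_form \<gamma> b w w 0" for w
    unfolding toeplitz_form_diag(2)[OF f] by (rule Bochner_Integration.integral_cong[OF refl F2])
  have "\<bar>toeplitz_form \<gamma> b u v j\<bar> = cmod (complex_of_real (toeplitz_form \<gamma> b u v j))" by simp
  also have "\<dots> \<le> (LINT x|circle_measure. cmod (of_real (f x) *
       (trig_poly b u x * cnj (trig_poly b v x) * cis (- of_int j * x))))"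
    unfolding toeplitz_form_spectral[OF f] by (rule integral_norm_bound)
  also have "\<dots> = (LINT x|circle_measure. F u x * F v x)"
  proof (rule Bochner_Integration.integral_cong[OF refl])
    fix x assume "x \<in> space circle_measure"
    then have "f x = sqrt (f x) * sqrt (f x)" and "0 \<le> f x" using fnn by auto
    then show "cmod (of_real (f x) * (trig_poly b u x * cnj (trig_poly b v x) * cis (- of_int j * x)))
        = F u x * F v x"
      by (simp add: norm_mult F_def)
  qed
  also have "\<dots> \<le> sqrt ((LINT x|circle_measure. (F u x)\<^sup>2) * (LINT x|circle_measure. (F v x)\<^sup>2))"
    by (rule real_le_rsqrt) (rule integral_Cauchy_Schwarz(2)[OF Fm Fm F2i F2i])
  finally show ?thesis by (simp add: F2e real_sqrt_mult)
qed

text \<open>Transfers estimates in the variance of the fractional process to the variance of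
  \<open>Z\<close>: the spectral integrands compare pointwise because the squared modulus is
  nonnegative.\<close>

lemma toeplitz_form_mono:
  assumes f: "spectral_density (\<lambda>x. h x * f\<^sub>0 x) \<gamma>" and h: "spectral_density h g"
    and c: "\<And>x. x \<in> {-pi<..pi} \<Longrightarrow> c \<le> f\<^sub>0 x"
  shows "c * toeplitz_form g b u u 0 \<le> toeplitz_form \<gamma> b u u 0"
proof -
  have "c * toeplitz_form g b u u 0
      = (LINT x|circle_measure. c * (h x * (cmod (trig_poly b u x))\<^sup>2))"
    by (simp add: toeplitz_form_diag(2)[OF h])
  also have "\<dots> \<le> (LINT x|circle_measure. h x * f\<^sub>0 x * (cmod (trig_poly b u x))\<^sup>2)"
  proof (rule Bochner_Integration.integral_mono)
    fix x assume "x \<in> space circle_measure"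
    then have "0 \<le> h x" "c \<le> f\<^sub>0 x" using spectral_density_nonneg[OF h] c space_circle by auto
    then have "h x * (cmod (trig_poly b u x))\<^sup>2 * c \<le> h x * (cmod (trig_poly b u x))\<^sup>2 * f\<^sub>0 x"
      by (intro mult_left_mono) auto
    then show "c * (h x * (cmod (trig_poly b u x))\<^sup>2) \<le> h x * f\<^sub>0 x * (cmod (trig_poly b u x))\<^sup>2"
      by (simp add: mult_ac)
  qed (use toeplitz_form_diag(1)[OF h] toeplitz_form_diag(1)[OF f] in simp_all)
  finally show ?thesis by (simp add: toeplitz_form_diag(2)[OF f])
qed

section \<open>Covariance function of the fractional density\<close>

text \<open>Passes to the gauge integral on the closed interval, where reflection and the
  fundamental theorem apply; the endpoint \<open>-pi\<close> is negligible.\<close>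

lemma circle_integral_has_integral:
  fixes f :: "real \<Rightarrow> 'a :: euclidean_space"
  assumes "integrable circle_measure f"
  shows "(f has_integral (LINT x|circle_measure. f x)) {-pi..pi}"
proof -
  have si: "set_integrable lborel {-pi<..pi} f"
    using assms by (simp add: set_integrable_def integrable_restrict_space)
  have "(LINT x|circle_measure. f x) = (LINT x:{-pi<..pi}|lborel. f x)"
    by (simp add: set_lebesgue_integral_def integral_restrict_space)
  then have "(f has_integral (LINT x|circle_measure. f x)) {-pi<..pi}"
    using set_borel_integral_eq_integral[OF si] by (simp add: has_integral_integral)
  moreover have "negligible {x \<in> {-pi<..pi} - {-pi..pi}. f x \<noteq> 0}"
    by (rule negligible_subset[of "{}"]) auto
  moreover have "negligible {x \<in> {-pi..pi} - {-pi<..pi}. f x \<noteq> 0}"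
    by (rule negligible_subset[of "{-pi}"]) auto
  ultimately show ?thesis using has_integral_spike_set_eq by blast
qed

lemma norm_one_minus_cis: "cmod (1 - cis x) = 2 * \<bar>sin (x / 2)\<bar>"
  using dist_exp_i_1[of x] by (simp add: cis_conv_exp norm_minus_commute)

lemma fractional_density_eq:
  "fractional_density d x = cmod (1 - cis x) powr (- 2 * d) / (2 * pi)"
  by (simp add: fractional_density_def cis_conv_exp)

text \<open>Squaring the sine removes the absolute value, which leaves a base that is differentiable
  everywhere.\<close>

lemma fractional_density_sin:
  "fractional_density d x = (4 * (sin (x / 2))\<^sup>2) powr (- d) / (2 * pi)"
proof -
  have "4 * (sin (x / 2))\<^sup>2 = (2 * \<bar>sin (x / 2)\<bar>) powr 2"
    by (cases "sin (x/2) = 0") (simp_all add: powr_numeral power_mult_distrib)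
  then have "(4 * (sin (x / 2))\<^sup>2) powr (- d) = (2 * \<bar>sin (x / 2)\<bar>) powr (- 2 * d)"
    by (simp only: powr_powr) simp
  then show ?thesis by (simp add: fractional_density_eq norm_one_minus_cis)
qed

lemma fractional_density_measurable: "fractional_density d \<in> borel_measurable borel"
  unfolding fractional_density_sin[abs_def] by measurable

lemma fractional_density_nonneg: "0 \<le> fractional_density d x"
  by (simp add: fractional_density_eq)

text \<open>The density is even, so the sine parts of its Fourier coefficients vanish and the cosine
  integrals are the full coefficients.\<close>

lemma spectral_density_fractional:
  assumes int: "integrable circle_measure (fractional_density d)"
  shows "spectral_density (fractional_density d)
    (\<lambda>n. LINT x|circle_measure. fractional_density d x * cos (of_int n * x))"
proof -
  have si: "set_integrable lborel {-pi<..pi} (fractional_density d)"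
    using int by (simp add: set_integrable_def integrable_restrict_space)
  have "complex_of_real (LINT x|circle_measure. fractional_density d x * cos (of_int n * x)) =
    (LINT x|circle_measure. of_real (fractional_density d x) * cis (of_int n * x))" for n
  proof (rule complex_eqI)
    have ci: "integrable circle_measure (\<lambda>x. of_real (fractional_density d x) * cis (of_int n * x))"
      by (rule integrable_circle_mult_bounded[OF int, of _ 1]) (simp_all add: cis_mult_measurable)
    show "Re (complex_of_real (LINT x|circle_measure. fractional_density d x * cos (of_int n * x))) =
      Re (LINT x|circle_measure. of_real (fractional_density d x) * cis (of_int n * x))"
      by (subst integral_Re[OF ci, symmetric]) simp
    define I where "I = (LINT x|circle_measure. fractional_density d x * sin (of_int n * x))"
    have "integrable circle_measure (\<lambda>x. Im (of_real (fractional_density d x) * cis (of_int n * x)))"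
      using ci by (rule integrable_Im)
    then have "integrable circle_measure (\<lambda>x. fractional_density d x * sin (of_int n * x))" by simp
    from circle_integral_has_integral[OF this]
    have hi: "((\<lambda>x. fractional_density d x * sin (of_int n * x)) has_integral I) {-pi..pi}"
      by (simp add: I_def)
    have "((\<lambda>x. fractional_density d (-x) * sin (of_int n * -x)) has_integral I) {-pi..pi}"
      using hi has_integral_reflect_real[of "\<lambda>x. fractional_density d x * sin (of_int n * x)" I pi "-pi"]
      by simp
    moreover have "fractional_density d (-x) * sin (of_int n * -x)
        = - (fractional_density d x * sin (of_int n * x))" for x
      by (simp add: fractional_density_sin)
    ultimately have "((\<lambda>x. - (fractional_density d x * sin (of_int n * x))) has_integral I) {-pi..pi}"
      by (simp only:)
    with has_integral_neg[OF hi] have "I = - I" by (rule has_integral_unique[rotated])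
    then have "I = 0" by simp
    then show "Im (complex_of_real (LINT x|circle_measure. fractional_density d x * cos (of_int n * x))) =
      Im (LINT x|circle_measure. of_real (fractional_density d x) * cis (of_int n * x))"
      by (subst integral_Im[OF ci, symmetric]) (simp add: I_def)
  qed
  then show ?thesis
    using si by (simp add: spectral_density_def fractional_density_nonneg set_lebesgue_integral_def
        integral_restrict_space cis_conv_exp mult.assoc)
qed

text \<open>The recurrence says that the derivative of \<open>(4 sin\<^sup>2 (x/2)) powr (-d) * sin (x/2) * cos ((n + 1/2) x)\<close>
  integrates to 0 over the circle.\<close>

lemma fractional_coeff_rec:
  assumes d: "0 < d" "d < 1 / 2" and g: "spectral_density (fractional_density d) g"
  shows "(real n + 1 - d) * g (int n + 1) = (real n + d) * g (int n)"
proof -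
  \<comment> \<open>The half-integer frequency lies midway between \<open>n\<close> and
    \<open>n + 1\<close>: both cosines expand in \<open>N * x\<close> and \<open>x / 2\<close>, so
    the derivative of \<open>G\<close> combines exactly the two adjacent coefficients.\<close>
  define N where "N = real n + 1 / 2"
  define P where "P x = (4 * (sin (x / 2))\<^sup>2) powr (- d)" for x :: real
  define G where "G x = P x * sin (x / 2) * cos (N * x)" for x
  define G' where "G' x = pi * ((real n + 1 - d) * (fractional_density d x * cos (of_int (int n + 1) * x))
      - (real n + d) * (fractional_density d x * cos (of_int (int n) * x)))" for x
  have s0: "sin (x / 2) \<noteq> 0" if "x \<in> {-pi..pi}" "x \<noteq> 0" for x :: real
  proof -
    have "0 < sin (\<bar>x\<bar> / 2)" using that by (intro sin_gt_zero) auto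
    then show ?thesis by (cases "0 \<le> x") auto
  qed
  have deriv: "(G has_real_derivative G' x) (at x)" if x: "x \<in> {-pi..pi}" "x \<noteq> 0" for x
  proof -
    note s = s0[OF x]
    have dP: "(P has_real_derivative - d * P x * cos (x / 2) / sin (x / 2)) (at x)"
    proof -
      define y where "y = 4 * (sin (x / 2))\<^sup>2"
      have y: "0 < y" using s by (simp add: y_def)
      have "((\<lambda>x. 4 * (sin (x / 2))\<^sup>2) has_real_derivative 4 * sin (x / 2) * cos (x / 2)) (at x)"
        by (auto intro!: derivative_eq_intros)
      from DERIV_fun_powr[OF this, of "- d"] y
      have "(P has_real_derivative - d * y powr (- d - 1) * (4 * sin (x / 2) * cos (x / 2))) (at x)"
        by (simp add: y_def P_def[abs_def])
      moreover have "y powr (- d - 1) = P x / y"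
        using y by (simp add: powr_diff P_def y_def)
      ultimately show ?thesis using s by (simp add: y_def power2_eq_square mult.assoc)
    qed
    have dG: "(G has_real_derivative
       (- d * P x * cos (x / 2) / sin (x / 2)) * sin (x / 2) * cos (N * x)
        + P x * (cos (x / 2) / 2) * cos (N * x) - P x * sin (x / 2) * (N * sin (N * x))) (at x)"
    proof -
      have ds: "((\<lambda>x. sin (x / 2)) has_real_derivative cos (x / 2) / 2) (at x)"
        by (auto intro!: derivative_eq_intros)
      have dc: "((\<lambda>x. cos (N * x)) has_real_derivative - N * sin (N * x)) (at x)"
        by (auto intro!: derivative_eq_intros)
      from DERIV_mult[OF DERIV_mult[OF dP ds] dc] show ?thesis
        unfolding G_def[abs_def] by (simp add: algebra_simps)
    qed
    have c1: "cos (of_int (int n + 1) * x) = cos (N * x) * cos (x / 2) - sin (N * x) * sin (x / 2)"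
      unfolding cos_add[symmetric] by (rule arg_cong[of _ _ cos]) (simp add: N_def field_simps)
    have c0: "cos (of_int (int n) * x) = cos (N * x) * cos (x / 2) + sin (N * x) * sin (x / 2)"
      unfolding cos_diff[symmetric] by (rule arg_cong[of _ _ cos]) (simp add: N_def field_simps)
    have f: "fractional_density d x = P x / (2 * pi)" by (simp add: fractional_density_sin P_def)
    have "(- d * P x * cos (x / 2) / sin (x / 2)) * sin (x / 2) * cos (N * x)
        + P x * (cos (x / 2) / 2) * cos (N * x) - P x * sin (x / 2) * (N * sin (N * x)) = G' x"
      unfolding G'_def c0 c1 f using s by (simp add: N_def field_simps)
    with dG show ?thesis by simp
  qed
  have cont: "continuous_on {-pi..pi} G"
  proof (rule continuous_at_imp_continuous_on, rule ballI)
    fix x :: real assume x: "x \<in> {-pi..pi}"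
    show "isCont G x"
    proof (cases "x = 0")
      case False
      then show ?thesis using deriv[OF x] DERIV_isCont by blast
    next
      \<comment> \<open>The sine factor beats the singularity: \<open>G\<close> is dominated by a
        power with exponent \<open>1 / 2 - d > 0\<close> of a base that vanishes at the
        origin.\<close>
      case True
      have "continuous_on UNIV (\<lambda>x. (4 * (sin (x / 2))\<^sup>2) powr (1 / 2 - d) :: real)"
        using d by (intro continuous_on_powr' continuous_intros) auto
      then have "isCont (\<lambda>x. (4 * (sin (x / 2))\<^sup>2) powr (1 / 2 - d) :: real) 0"
        by (simp add: continuous_on_eq_continuous_at)
      then have lim: "((\<lambda>x. (4 * (sin (x / 2))\<^sup>2) powr (1 / 2 - d) :: real) \<longlongrightarrow> 0) (at 0)"
        by (simp add: isCont_def)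
      have "(G \<longlongrightarrow> 0) (at 0)"
      proof (rule Lim_null_comparison[OF _ lim], rule always_eventually, rule allI)
        fix x :: real
        define y where "y = 4 * (sin (x / 2))\<^sup>2"
        have y: "0 \<le> y" by (simp add: y_def)
        have "\<bar>2 * sin (x / 2)\<bar> = sqrt y" by (simp add: y_def real_sqrt_mult)
        then have "\<bar>sin (x / 2)\<bar> \<le> sqrt y" by simp
        then have "norm (G x) \<le> y powr (- d) * sqrt y * 1"
          unfolding G_def P_def y_def[symmetric] norm_mult
          using y by (intro mult_mono) auto
        also have "\<dots> = y powr (1 / 2 - d)"
          using y by (simp add: powr_half_sqrt[symmetric] powr_add[symmetric])
        finally show "norm (G x) \<le> (4 * (sin (x / 2))\<^sup>2) powr (1 / 2 - d)" by (simp add: y_def)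
      qed
      moreover have "G 0 = 0" by (simp add: G_def)
      ultimately show ?thesis using True by (simp add: isCont_def)
    qed
  qed
  \<comment> \<open>No derivative is claimed at the origin; continuity there lets the fundamental
    theorem pass over one exceptional point.\<close>
  have "(G' has_integral (G pi - G (-pi))) {-pi..pi}"
    by (rule fundamental_theorem_of_calculus_interior_strong[OF _ _ _ cont, of "{0}"])
      (use deriv in \<open>auto simp: has_real_derivative_iff_has_vector_derivative[symmetric]\<close>)
  \<comment> \<open>At a half-integer frequency the cosine vanishes at both ends, which kills the
    boundary terms.\<close>
  moreover have "cos (N * pi) = 0"
    by (simp add: N_def distrib_right cos_add)
  then have "G pi = 0" "G (-pi) = 0" by (simp_all add: G_def)
  ultimately have G0: "(G' has_integral 0) {-pi..pi}" by simp
  have int: "integrable circle_measure (\<lambda>x. fractional_density d x * cos (of_int m * x))" for m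
  proof -
    have "integrable circle_measure (\<lambda>x. of_real (fractional_density d x) * cis (of_int m * x))"
      by (rule integrable_circle_mult_bounded[OF spectral_density_integrable[OF g], of _ 1])
        (simp_all add: cis_mult_measurable)
    from integrable_Re[OF this] show ?thesis by simp
  qed
  have hg: "((\<lambda>x. fractional_density d x * cos (of_int m * x)) has_integral g m) {-pi..pi}" for m
    using circle_integral_has_integral[OF int] by (simp add: spectral_density_cos[OF g])
  have "(G' has_integral pi * ((real n + 1 - d) * g (int n + 1) - (real n + d) * g (int n))) {-pi..pi}"
    unfolding G'_def[abs_def] by (intro has_integral_mult_right has_integral_diff hg)
  from has_integral_unique[OF this G0] show ?thesis by simp
qed

text \<open>The Beta values obey the same recurrence: raising the first argument of
  \<open>Beta x y\<close> by 1 multiplies it by \<open>x / (x + y)\<close>, and here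
  \<open>x + y = n + 1 - d\<close>. The two sequences agree at 0, and \<open>g 0\<close> itself is
  never evaluated.\<close>

lemma fractional_coeff_Beta:
  assumes d: "0 < d" "d < 1 / 2" and g: "spectral_density (fractional_density d) g"
  shows "g (int n) = g 0 / Beta d (1 - 2 * d) * Beta (real n + d) (1 - 2 * d)"
proof (induction n)
  case 0
  have "Beta d (1 - 2 * d) > 0" using d by (simp add: Beta_def Gamma_real_pos)
  then show ?case by simp
next
  case (Suc n)
  have "real n + d \<notin> \<int>\<^sub>\<le>\<^sub>0" using d by (auto elim!: nonpos_Ints_cases)
  from Beta_plus1_left[OF this, of "1 - 2 * d"]
  have "(real n + 1 - d) * Beta (real (Suc n) + d) (1 - 2 * d)
      = (real n + d) * Beta (real n + d) (1 - 2 * d)"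
    by (simp add: algebra_simps)
  then have "(real n + 1 - d) * (g 0 / Beta d (1 - 2 * d) * Beta (real (Suc n) + d) (1 - 2 * d))
     = (real n + d) * g (int n)"
    unfolding Suc.IH by (simp add: field_simps)
  also have "\<dots> = (real n + 1 - d) * g (int (Suc n))"
    using fractional_coeff_rec[OF d g, of n] by (simp add: add.commute)
  finally have "(real n + 1 - d) * (g 0 / Beta d (1 - 2 * d) * Beta (real (Suc n) + d) (1 - 2 * d))
    = (real n + 1 - d) * g (int (Suc n))" .
  moreover have "real n + 1 - d \<noteq> 0" using d by auto
  ultimately show ?case by (metis mult_left_cancel)
qed

section \<open>Point evaluations of trigonometric polynomials\<close>

text \<open>A Gautschi-type bound for a ratio of Gamma values. The constant 2 pays for replacing
  \<open>a + y\<close> by \<open>2 * a\<close>.\<close>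

lemma Beta_le_powr:
  fixes a y :: real
  assumes y: "0 < y" "y < 1" and a: "1 \<le> a"
  shows "Beta a y \<le> 2 * Gamma y * a powr (- y)"
proof -
  have pos: "0 < Gamma a" "0 < Gamma (a + y)" "0 < Gamma y" using a y by (auto intro: Gamma_real_pos)
  \<comment> \<open>Log-convexity of Gamma at \<open>a + 1 = y (a + y) + (1 - y) (a + y + 1)\<close>.\<close>
  have "(ln \<circ> Gamma) ((1 - (1 - y)) *\<^sub>R (a + y) + (1 - y) *\<^sub>R (a + y + 1))
      \<le> (1 - (1 - y)) * (ln \<circ> Gamma) (a + y) + (1 - y) * (ln \<circ> Gamma) (a + y + 1)"
    by (rule convex_onD[OF log_convex_Gamma_real]) (use a y in auto)
  moreover have "(1 - (1 - y)) *\<^sub>R (a + y) + (1 - y) *\<^sub>R (a + y + 1) = a + 1"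
    by (simp add: algebra_simps)
  moreover have "Gamma (a + 1) = a * Gamma a" using a by (subst Gamma_plus1) (auto elim!: nonpos_Ints_cases)
  moreover have "Gamma (a + y + 1) = (a + y) * Gamma (a + y)"
    using a y by (subst Gamma_plus1) (auto elim!: nonpos_Ints_cases)
  ultimately have "ln (a * Gamma a) \<le> y * ln (Gamma (a + y)) + (1 - y) * ln ((a + y) * Gamma (a + y))"
    by simp
  also have "\<dots> = ln (Gamma (a + y) * (a + y) powr (1 - y))"
  proof -
    have "ln ((a + y) * Gamma (a + y)) = ln (a + y) + ln (Gamma (a + y))"
      by (rule ln_mult_pos) (use a y pos in auto)
    moreover have "ln (Gamma (a + y) * (a + y) powr (1 - y)) = ln (Gamma (a + y)) + (1 - y) * ln (a + y)"
      using a y pos by (subst ln_mult_pos) (auto simp: ln_powr)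
    ultimately show ?thesis by (simp only:) (simp add: algebra_simps)
  qed
  finally have "a * Gamma a \<le> Gamma (a + y) * (a + y) powr (1 - y)"
    using a y pos by (subst (asm) ln_le_cancel_iff) auto
  also have "(a + y) powr (1 - y) \<le> (2 * a) powr (1 - y)"
    using a y by (intro powr_mono2) auto
  also have "\<dots> \<le> 2 * a powr (1 - y)"
    using a y powr_mono[of "1 - y" 1 2] by (simp add: powr_mult mult_right_mono)
  also have "a powr (1 - y) = a * a powr (- y)" using a powr_add[of a 1 "-y"] by simp
  finally have "a * Gamma a \<le> a * (Gamma (a + y) * (2 * a powr (- y)))"
    using pos by (simp add: mult_left_mono mult_ac)
  then have "Gamma a \<le> Gamma (a + y) * (2 * a powr (- y))" using a by simp
  then show ?thesis using pos by (simp add: Beta_def rGamma_inverse_Gamma field_simps)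
qed

text \<open>Jordan's inequality: concavity keeps the sine above its chord on
  \<open>[0, pi / 2]\<close>. This gives slope \<open>2 / pi\<close>, weakened to
  \<open>1 / 2\<close> by \<open>pi < 4\<close>.\<close>

lemma abs_le_norm_one_minus_cis:
  assumes "x \<in> {-pi..pi}"
  shows "\<bar>x\<bar> / 2 \<le> cmod (1 - cis x)"
proof -
  define t where "t = \<bar>x\<bar> / pi"
  have t: "0 \<le> t" "t \<le> 1" using assms by (auto simp: t_def field_simps)
  have "convex_on {0..pi / 2} (\<lambda>x. - sin x)"
    by (rule f''_ge0_imp_convex[where f' = "\<lambda>x. - cos x" and f'' = sin])
      (auto intro!: derivative_eq_intros sin_ge_zero)
  from convex_onD[OF this t, of 0 "pi / 2"] have "t \<le> sin (\<bar>x\<bar> / 2)" by (simp add: t_def)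
  also have "\<dots> = \<bar>sin (x / 2)\<bar>"
  proof (cases "0 \<le> x")
    case True
    then have "0 \<le> sin (x / 2)" using assms by (intro sin_ge_zero) auto
    with True show ?thesis by simp
  next
    case False
    then have "0 \<le> sin (- x / 2)" using assms by (intro sin_ge_zero) auto
    with False show ?thesis by simp
  qed
  finally have "2 * t \<le> cmod (1 - cis x)" by (simp add: norm_one_minus_cis)
  moreover have "\<bar>x\<bar> / 2 \<le> 2 * t"
    using pi_less_4 mult_left_mono[of pi 4 "\<bar>x\<bar>"] by (simp add: t_def field_simps)
  ultimately show ?thesis by linarith
qed

text \<open>Going from \<open>z\<close> to its radial contraction moves it by \<open>1 - r\<close>,
  which is the distance from 1 to the circle of radius \<open>r\<close> and hence at most
  \<open>cmod (1 - of_real r * z)\<close>. The constant is therefore uniform in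
  \<open>r\<close>.\<close>

lemma norm_one_minus_le_radial:
  assumes "0 \<le> r" "r \<le> 1" and "cmod z = 1"
  shows "cmod (1 - z) \<le> 2 * cmod (1 - of_real r * z)"
proof -
  have "1 - z = (1 - of_real r * z) - of_real (1 - r) * z" by (simp add: algebra_simps)
  also have "cmod \<dots> \<le> cmod (1 - of_real r * z) + cmod (of_real (1 - r) * z)"
    by (rule norm_triangle_ineq4)
  also have "cmod (of_real (1 - r) * z) = cmod 1 - cmod (of_real r * z)"
    using assms by (simp add: norm_mult del: of_real_diff)
  also have "\<dots> \<le> cmod (1 - of_real r * z)" by (rule norm_triangle_ineq2)
  finally show ?thesis by simp
qed

text \<open>Size and decay of a truncated geometric series, uniformly in the ratio. In the decay
  bound one factor 2 comes from the numerator \<open>1 - z ^ b\<close> and the other from the radial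
  comparison.\<close>

lemma trig_poly_geometric_bound:
  assumes r: "0 \<le> r" "r \<le> 1"
  shows "cmod (trig_poly b (\<lambda>i. r ^ i) x) \<le> real b"
    and "cmod (trig_poly b (\<lambda>i. r ^ i) x) * cmod (1 - cis x) \<le> 4"
proof -
  have "cmod (trig_poly b (\<lambda>i. r ^ i) x) \<le> (\<Sum>i<b. \<bar>r ^ i\<bar>)" by (rule norm_trig_poly_le)
  also have "\<dots> \<le> (\<Sum>i<b. 1)" using r by (intro sum_mono) (auto simp: power_le_one)
  finally show "cmod (trig_poly b (\<lambda>i. r ^ i) x) \<le> real b" by simp
  define z where "z = of_real r * cis x"
  have cz: "cmod z \<le> 1" using r by (simp add: z_def norm_mult)
  have "trig_poly b (\<lambda>i. r ^ i) x = (\<Sum>i<b. z ^ i)"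
    by (simp add: trig_poly_def z_def power_mult_distrib Complex.DeMoivre)
  then have "trig_poly b (\<lambda>i. r ^ i) x * (1 - z) = 1 - z ^ b"
    by (simp add: one_diff_power_eq mult.commute)
  then have "cmod (trig_poly b (\<lambda>i. r ^ i) x) * cmod (1 - z) = cmod (1 - z ^ b)"
    by (metis norm_mult)
  also have "\<dots> \<le> cmod 1 + cmod (z ^ b)" by (rule norm_triangle_ineq4)
  also have "\<dots> \<le> 2" using cz by (simp add: norm_power power_le_one)
  finally have "2 * (cmod (trig_poly b (\<lambda>i. r ^ i) x) * cmod (1 - z)) \<le> 4" by linarith
  then have "cmod (trig_poly b (\<lambda>i. r ^ i) x) * (2 * cmod (1 - z)) \<le> 4"
    by (simp only: mult.left_commute)
  moreover have "cmod (1 - cis x) \<le> 2 * cmod (1 - z)"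
    unfolding z_def by (rule norm_one_minus_le_radial) (use r in auto)
  ultimately show "cmod (trig_poly b (\<lambda>i. r ^ i) x) * cmod (1 - cis x) \<le> 4"
    by (meson mult_left_mono norm_ge_zero order_trans)
qed

text \<open>Reversing the coefficients reflects \<open>x\<close> up to a unimodular factor. It is
  needed because the earlier block appears with its powers in descending order.\<close>

lemma norm_trig_poly_reverse:
  "cmod (trig_poly b (\<lambda>i. r ^ (b - 1 - i)) x) = cmod (trig_poly b (\<lambda>i. r ^ i) (- x))"
proof (cases "b = 0")
  case False
  have "trig_poly b (\<lambda>i. r ^ (b - 1 - i)) x
     = (\<Sum>i<b. of_real (r ^ (b - 1 - i)) * cis (real i * x))" by (simp add: trig_poly_def)
  also have "\<dots> = (\<Sum>i<b. of_real (r ^ i) * cis (real (b - 1 - i) * x))"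
    by (subst sum.nat_diff_reindex[symmetric]) (auto intro!: sum.cong)
  also have "\<dots> = (\<Sum>i<b. cis (real (b - 1) * x) * (of_real (r ^ i) * cis (real i * (- x))))"
  proof (rule sum.cong[OF refl])
    fix i assume "i \<in> {..<b}"
    then have "real (b - 1 - i) = real (b - 1) - real i" by auto
    then have "cis (real (b - 1 - i) * x) = cis (real (b - 1) * x) * cis (real i * (- x))"
      by (simp only: cis_mult) (simp add: algebra_simps)
    then show "of_real (r ^ i) * cis (real (b - 1 - i) * x)
      = cis (real (b - 1) * x) * (of_real (r ^ i) * cis (real i * (- x)))" by simp
  qed
  also have "\<dots> = cis (real (b - 1) * x) * trig_poly b (\<lambda>i. r ^ i) (- x)"
    by (simp add: trig_poly_def sum_distrib_left)
  finally show ?thesis by (simp add: norm_mult)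
qed (simp add: trig_poly_def)

lemma trig_poly_geometric_reverse_bound:
  assumes r: "0 \<le> r" "r \<le> 1"
  shows "cmod (trig_poly b (\<lambda>i. r ^ (b - 1 - i)) x) \<le> real b"
    and "cmod (trig_poly b (\<lambda>i. r ^ (b - 1 - i)) x) * cmod (1 - cis x) \<le> 4"
  using trig_poly_geometric_bound[OF r, of b "-x"]
  by (simp_all only: norm_trig_poly_reverse) (simp add: norm_one_minus_cis)

text \<open>Orthogonality of the exponentials, phrased for a spectral density so that
  \<open>toeplitz_form_spectral\<close> turns the Euclidean inner product of coefficients into an
  integral.\<close>

lemma spectral_density_white_noise:
  "spectral_density (\<lambda>_. 1 / (2 * pi)) (\<lambda>n. if n = 0 then 1 else 0)"
proof -
  have int: "(LINT x|circle_measure. cis (of_int n * x)) = (if n = 0 then 2 * of_real pi else 0)" for n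
  proof (cases "n = 0")
    case True
    then show ?thesis
      by (simp add: integral_restrict_space measure_restrict_space space_restrict_space scaleR_conv_of_real)
  next
    case False
    have "integrable circle_measure (\<lambda>x. of_real 1 * cis (of_int n * x))"
      by (rule integrable_circle_mult_bounded[of _ _ 1])
        (simp_all add: cis_mult_measurable finite_measure.integrable_const[OF finite_measure_circle])
    then have 1: "((\<lambda>x. cis (of_int n * x)) has_integral (LINT x|circle_measure. cis (of_int n * x))) {-pi..pi}"
      by (intro circle_integral_has_integral) simp
    define F where "F x = cis (of_int n * x) / (\<i> * of_int n)" for x
    have "((\<lambda>x. cis (of_int n * x)) has_integral (F pi - F (-pi))) {-pi..pi}"
    proof (rule fundamental_theorem_of_calculus)
      fix x :: real
      show "(F has_vector_derivative cis (of_int n * x)) (at x within {-pi..pi})"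
        unfolding F_def[abs_def] cis_conv_exp using False
        by (auto intro!: derivative_eq_intros has_vector_derivative_real_field simp: field_simps)
    qed simp
    moreover have "cis (of_int n * pi) = cis (of_int n * (-pi))"
    proof -
      have "cis (of_int n * pi) = cis (of_int n * (-pi)) * cis (2 * pi * of_int n)"
        by (simp only: cis_mult) (simp add: algebra_simps)
      moreover have "cis (2 * pi * of_int n) = 1" by (rule cis_multiple_2pi) simp
      ultimately show ?thesis by (simp only: mult_1_right)
    qed
    then have "F pi - F (-pi) = 0" by (simp add: F_def)
    ultimately show ?thesis using has_integral_unique[OF 1] False by metis
  qed
  have "complex_of_real (if n = 0 then 1 else 0) = (LINT x:{-pi<..pi}|lborel.
          complex_of_real (1 / (2 * pi)) * exp (\<i> * of_int n * of_real x))" for n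
  proof -
    have "(LINT x:{-pi<..pi}|lborel. complex_of_real (1 / (2 * pi)) * exp (\<i> * of_int n * of_real x))
        = (LINT x|circle_measure. complex_of_real (1 / (2 * pi)) * cis (of_int n * x))"
      by (simp add: set_lebesgue_integral_def integral_restrict_space cis_conv_exp mult.assoc)
    then show ?thesis by (simp add: int)
  qed
  then show ?thesis by (simp add: spectral_density_def set_integrable_def)
qed

text \<open>Squared kernels of height \<open>1 / t\<close> and decay \<open>1 / \<bar>x\<bar>\<close>, weighted by \<open>\<bar>x\<bar> powr (2 d)\<close>, are
  dominated by the function p, which has an elementary antiderivative on each half of the circle.\<close>

lemma circle_integral_peak_bound:
  assumes d: "d < 1 / 2" and t: "0 < t"
  defines "p \<equiv> \<lambda>x. (\<bar>x\<bar> / 2 + t) powr (2 * d - 2)"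
  shows "integrable circle_measure p"
    and "(LINT x|circle_measure. p x) \<le> 4 / (1 - 2 * d) * t powr (2 * d - 1)"
proof -
  have cont: "continuous_on A p" for A
    unfolding p_def using t by (intro continuous_intros) (auto simp: add_nonneg_eq_0_iff)
  interpret finite_measure circle_measure by (rule finite_measure_circle)
  show int: "integrable circle_measure p"
  proof (rule integrable_const_bound[of _ "t powr (2 * d - 2)"])
    show "AE x in circle_measure. norm (p x) \<le> t powr (2 * d - 2)"
      using t d by (intro AE_I2) (auto simp: p_def intro!: powr_mono2')
    show "p \<in> borel_measurable circle_measure"
      by (intro borel_measurable_circle borel_measurable_continuous_onI cont)
  qed
  define F where "F x = - 2 / (1 - 2 * d) * (x / 2 + t) powr (2 * d - 1)" for x
  have r: "(p has_integral (F pi - F 0)) {0..pi}"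
  proof (rule fundamental_theorem_of_calculus)
    fix x :: real assume x: "x \<in> {0..pi}"
    then have pos: "x / 2 + t > 0" using t by (simp add: add_nonneg_pos)
    have "((\<lambda>x. x / 2 + t) has_real_derivative 1 / 2) (at x)"
      by (auto intro!: derivative_eq_intros)
    from DERIV_cmult[OF DERIV_fun_powr[OF this pos, of "2 * d - 1"], of "- 2 / (1 - 2 * d)"]
    have "(F has_real_derivative - 2 / (1 - 2 * d) *
        ((2 * d - 1) * (x / 2 + t) powr (2 * d - 1 - 1) * (1 / 2))) (at x)"
      by (simp add: F_def[abs_def])
    moreover have "- 2 / (1 - 2 * d) * ((2 * d - 1) * (x / 2 + t) powr (2 * d - 1 - 1) * (1 / 2)) = p x"
      using x d by (simp add: p_def field_simps)
    ultimately show "(F has_vector_derivative p x) (at x within {0..pi})"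
      using has_real_derivative_iff_has_vector_derivative has_vector_derivative_at_within by metis
  qed simp
  have "((\<lambda>x. p (- x)) has_integral (F pi - F 0)) {-pi..-0}"
    by (subst has_integral_reflect_real) (rule r)
  then have l: "(p has_integral (F pi - F 0)) {-pi..0}" by (simp add: p_def)
  have "(p has_integral ((F pi - F 0) + (F pi - F 0))) {-pi..pi}"
    by (rule Henstock_Kurzweil_Integration.has_integral_combine[OF _ _ l r]) auto
  from has_integral_unique[OF circle_integral_has_integral[OF int] this]
  have "(LINT x|circle_measure. p x) = 2 * F pi - 2 * F 0" by simp
  also have "\<dots> \<le> - 2 * F 0" using d by (simp add: F_def)
  also have "\<dots> = 4 / (1 - 2 * d) * t powr (2 * d - 1)" by (simp add: F_def)
  finally show "(LINT x|circle_measure. p x) \<le> 4 / (1 - 2 * d) * t powr (2 * d - 1)" .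
qed

lemma AE_circle_nonzero: "AE x in circle_measure. x \<noteq> 0"
  by (subst AE_restrict_space_iff) (use AE_lborel_singleton[of "0::real"] in auto)

text \<open>Weighted duality: the coefficients \<open>a\<close> enter only through a height and a
  decay bound for their kernel, so one constant serves all geometric ratios. The power of
  \<open>b\<close> comes from integrating the squared kernel against a weight of order
  \<open>\<bar>x\<bar> powr (2 * d)\<close>.\<close>

lemma linear_functional_bound:
  assumes d: "0 < d" "d < 1 / 2" and g: "spectral_density (fractional_density d) g"
    and b: "1 \<le> b"
    and a1: "\<And>x. cmod (trig_poly b a x) \<le> real b"
    and a2: "\<And>x. cmod (trig_poly b a x) * cmod (1 - cis x) \<le> 4"
  shows "(\<Sum>i<b. u i * a i)\<^sup>2
    \<le> 100 / (1 - 2 * d) * real b powr (1 - 2 * d) * toeplitz_form g b u u 0"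
proof -
  define h where "h = fractional_density d"
  define F where "F x = sqrt (h x) * cmod (trig_poly b u x)" for x
  \<comment> \<open>Cauchy--Schwarz for the weights \<open>h\<close> and \<open>1 / h\<close>; at the origin both vanish, so F G is the
    integrand only almost everywhere.\<close>
  define G where "G x = sqrt (1 / h x) * cmod (trig_poly b a x) / (2 * pi)" for x
  define p where "p x = (\<bar>x\<bar> / 2 + 1 / real b) powr (2 * d - 2)" for x
  have hnn: "0 \<le> h x" for x by (simp add: h_def fractional_density_nonneg)
  note [measurable] = fractional_density_measurable trig_poly_measurable
  have Fb: "F \<in> borel_measurable borel" unfolding F_def[abs_def] h_def by measurable
  have Gb: "G \<in> borel_measurable borel" unfolding G_def[abs_def] h_def by measurable
  note FG[measurable] = borel_measurable_circle[OF Fb] borel_measurable_circle[OF Gb]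
  have F2: "(F x)\<^sup>2 = h x * (cmod (trig_poly b u x))\<^sup>2" for x
    by (simp add: F_def power_mult_distrib hnn)
  have F2i: "integrable circle_measure (\<lambda>x. (F x)\<^sup>2)"
    unfolding F2 h_def by (rule toeplitz_form_diag(1)[OF g])
  have F2e: "(LINT x|circle_measure. (F x)\<^sup>2) = toeplitz_form g b u u 0"
    unfolding F2 toeplitz_form_diag(2)[OF g] by (simp add: h_def)
  have tb: "0 < 1 / real b" using b by simp
  note p = circle_integral_peak_bound[OF d(2) tb, folded p_def]
  have G2: "(G x)\<^sup>2 \<le> 25 * p x" if x: "x \<in> {-pi<..pi}" for x
  proof -
    define y where "y = cmod (1 - cis x)"
    define K where "K = cmod (trig_poly b a x)"
    have y: "0 \<le> y" and K: "0 \<le> K" by (simp_all add: y_def K_def)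
    have xy: "\<bar>x\<bar> / 2 \<le> y" unfolding y_def using x by (intro abs_le_norm_one_minus_cis) auto
    \<comment> \<open>Height and decay add up to the single bound \<open>5 / (y + 1 / b)\<close> for
      the kernel.\<close>
    have "K / real b \<le> 1" using a1[of x] b by (simp add: K_def)
    moreover have "K * y \<le> 4" using a2[of x] by (simp add: K_def y_def)
    ultimately have "K * (y + 1 / real b) \<le> 5" by (simp add: distrib_left)
    then have "(K * (y + 1 / real b))\<^sup>2 \<le> 5\<^sup>2"
      using K y b by (intro power_mono) auto
    then have K2: "K\<^sup>2 \<le> 25 * (y + 1 / real b) powr (- 2)"
    proof -
      have W: "0 < y + 1 / real b" by (rule add_nonneg_pos[OF y tb])
      assume "(K * (y + 1 / real b))\<^sup>2 \<le> 5\<^sup>2"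
      then have "K\<^sup>2 \<le> 25 / (y + 1 / real b)\<^sup>2"
        using W by (subst pos_le_divide_eq) (auto simp: power_mult_distrib)
      also have "\<dots> = 25 * (y + 1 / real b) powr (- 2)"
        using W by (simp add: powr_minus powr_numeral divide_inverse)
      finally show ?thesis .
    qed
    \<comment> \<open>This also holds at the origin, where both sides are 0 by the conventions for
      \<open>powr\<close> and division.\<close>
    have "1 / h x = 2 * pi * y powr (2 * d)"
      by (simp add: h_def fractional_density_eq y_def powr_minus field_simps)
    moreover have "(sqrt (1 / h x))\<^sup>2 = 1 / h x" using hnn[of x] by simp
    moreover have "(G x)\<^sup>2 = (sqrt (1 / h x))\<^sup>2 * K\<^sup>2 / (2 * pi)\<^sup>2"
      by (simp only: G_def K_def power_mult_distrib power_divide)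
    ultimately have "(G x)\<^sup>2 = 2 * pi * y powr (2 * d) * K\<^sup>2 / (2 * pi)\<^sup>2"
      by (simp only:)
    then have "(G x)\<^sup>2 = y powr (2 * d) / (2 * pi) * K\<^sup>2"
      by (simp add: power2_eq_square)
    also have "\<dots> \<le> y powr (2 * d) / 1 * K\<^sup>2"
      using pi_gt3 by (intro mult_right_mono divide_left_mono) auto
    also have "\<dots> \<le> (y + 1 / real b) powr (2 * d) * (25 * (y + 1 / real b) powr (- 2))"
      using y tb d K2 by (intro mult_mono) (auto intro!: powr_mono2)
    also have "\<dots> = 25 * (y + 1 / real b) powr (2 * d - 2)"
      by (simp add: powr_add[symmetric])
    also have "\<dots> \<le> 25 * p x"
      unfolding p_def using xy tb d by (intro mult_left_mono powr_mono2') (auto intro: add_nonneg_pos)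
    finally show ?thesis .
  qed
  have G2': "AE x in circle_measure. norm ((G x)\<^sup>2) \<le> norm (25 * p x)"
    using G2 by (intro AE_I2) (auto simp: space_circle p_def)
  have G2i: "integrable circle_measure (\<lambda>x. (G x)\<^sup>2)"
    by (rule Bochner_Integration.integrable_bound[OF _ _ G2']) (use p(1) in auto)
  have "(LINT x|circle_measure. (G x)\<^sup>2) \<le> (LINT x|circle_measure. 25 * p x)"
    using G2 G2i p(1) by (intro Bochner_Integration.integral_mono) (auto simp: space_circle)
  also have "\<dots> \<le> 25 * (4 / (1 - 2 * d) * (1 / real b) powr (2 * d - 1))"
    using p(2) by simp
  also have "\<dots> = 100 / (1 - 2 * d) * real b powr (1 - 2 * d)"
    using b by (simp add: powr_divide powr_minus_divide[symmetric])
  finally have G2e: "(LINT x|circle_measure. (G x)\<^sup>2) \<le> 100 / (1 - 2 * d) * real b powr (1 - 2 * d)" .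
  \<comment> \<open>White noise pairs only equal indices, so its form at lag 0 is the plain inner
    product, to which the spectral formula applies.\<close>
  have "(\<Sum>i<b. u i * a i) = toeplitz_form (\<lambda>n. if n = 0 then 1 else 0) b u a 0"
  proof -
    have "(\<Sum>l<b. u i * a l * (if int i - int l - 0 = 0 then 1 else 0)) = u i * a i" if "i < b" for i
      using that by (subst sum.mono_neutral_right[of _ "{i}"]) auto
    then show ?thesis by (simp add: toeplitz_form_def)
  qed
  then have "\<bar>\<Sum>i<b. u i * a i\<bar> = cmod (LINT x|circle_measure. complex_of_real (1 / (2 * pi)) *
       (trig_poly b u x * cnj (trig_poly b a x) * cis (- of_int 0 * x)))"
    unfolding toeplitz_form_spectral[OF spectral_density_white_noise, symmetric]
    by (simp only: norm_of_real)
  also have "\<dots> \<le> (LINT x|circle_measure. cmod (complex_of_real (1 / (2 * pi)) *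
       (trig_poly b u x * cnj (trig_poly b a x) * cis (- of_int 0 * x))))"
    by (rule integral_norm_bound)
  also have "\<dots> = (LINT x|circle_measure. F x * G x)"
  proof (rule integral_cong_AE)
    show "AE x in circle_measure. cmod (complex_of_real (1 / (2 * pi)) *
       (trig_poly b u x * cnj (trig_poly b a x) * cis (- of_int 0 * x))) = F x * G x"
    proof (rule AE_mp[OF AE_circle_nonzero], rule AE_I2, rule impI)
      fix x assume "x \<in> space circle_measure" and x0: "x \<noteq> 0"
      then have "x \<in> {-pi..pi}" by (auto simp: space_circle)
      from abs_le_norm_one_minus_cis[OF this] x0 have "0 < cmod (1 - cis x)" by linarith
      then have "0 < h x" by (simp add: h_def fractional_density_eq)
      then show "cmod (complex_of_real (1 / (2 * pi)) *
       (trig_poly b u x * cnj (trig_poly b a x) * cis (- of_int 0 * x))) = F x * G x"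
        by (simp add: F_def G_def norm_mult norm_divide real_sqrt_divide)
    qed
    have "(\<lambda>x. cmod (complex_of_real (1 / (2 * pi)) *
       (trig_poly b u x * cnj (trig_poly b a x) * cis (- of_int 0 * x)))) \<in> borel_measurable borel"
      unfolding norm_mult complex_mod_cnj norm_cis by measurable
    then show "(\<lambda>x. cmod (complex_of_real (1 / (2 * pi)) *
       (trig_poly b u x * cnj (trig_poly b a x) * cis (- of_int 0 * x))))
       \<in> borel_measurable circle_measure" by (rule borel_measurable_circle)
  qed simp
  finally have "\<bar>\<Sum>i<b. u i * a i\<bar> \<le> (LINT x|circle_measure. F x * G x)" .
  then have "(\<Sum>i<b. u i * a i)\<^sup>2 \<le> (LINT x|circle_measure. F x * G x)\<^sup>2"
    by (metis abs_ge_zero power2_abs power_mono)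
  also have "\<dots> \<le> (LINT x|circle_measure. (F x)\<^sup>2) * (LINT x|circle_measure. (G x)\<^sup>2)"
    by (rule integral_Cauchy_Schwarz(2)[OF FG F2i G2i])
  also have "\<dots> \<le> toeplitz_form g b u u 0 * (100 / (1 - 2 * d) * real b powr (1 - 2 * d))"
    unfolding F2e by (rule mult_left_mono[OF G2e toeplitz_form_nonneg[OF g]])
  finally show ?thesis by (simp add: mult.commute)
qed

section \<open>Fractional Toeplitz forms at large lags\<close>

lemma toeplitz_form_minus:
  assumes "\<And>n. g (- n) = g n"
  shows "toeplitz_form g b u v (- j) = toeplitz_form g b v u j"
proof -
  have "g (int i - int l - - j) = g (int l - int i - j)" for i l
    using assms[of "int l - int i - j"] by (simp add: algebra_simps)
  then show ?thesis
    unfolding toeplitz_form_def by (subst sum.swap) (simp add: mult.commute)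
qed

text \<open>For \<open>b < j\<close> all entries have lags of the same sign, so the whole form
  becomes a single integral of \<open>U r * V r\<close> against the weight \<open>w\<close>. Both
  factors are bounded uniformly in \<open>r\<close>, and what remains is one Beta value with first
  argument of order \<open>j - b\<close>.\<close>

lemma fractional_toeplitz_decay_pos:
  assumes d: "0 < d" "d < 1 / 2" and g: "spectral_density (fractional_density d) g"
    and b: "1 \<le> b" "b < j"
  shows "\<bar>toeplitz_form g b u v (int j)\<bar> \<le>
    g 0 / Beta d (1 - 2 * d) * (100 / (1 - 2 * d)) * (2 * Gamma (1 - 2 * d))
      * (real b / (real j - real b)) powr (1 - 2 * d)
      * (sqrt (toeplitz_form g b u u 0) * sqrt (toeplitz_form g b v v 0))"
proof -
  define y where "y = 1 - 2 * d"
  define C where "C = g 0 / Beta d y"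
  define E where "E = 100 / y * real b powr y"
  define S where "S = sqrt (toeplitz_form g b u u 0) * sqrt (toeplitz_form g b v v 0)"
  define U where "U r = (\<Sum>i<b. u i * r ^ (b - 1 - i))" for r :: real
  define V where "V r = (\<Sum>l<b. v l * r ^ l)" for r :: real
  define m where "m = real j - real b"
  define w where "w r = r powr (m + d) * (1 - r) powr (y - 1)" for r :: real
  have y: "0 < y" "y < 1" using d by (auto simp: y_def)
  have m: "1 \<le> m" using b by (auto simp: m_def)
  have Bpos: "0 < Beta d y" using d y by (simp add: Beta_def Gamma_real_pos rGamma_inverse_Gamma)
  have g0: "0 \<le> g 0"
    using toeplitz_form_nonneg[OF g, of 1 "\<lambda>_. 1"] by (simp add: toeplitz_form_def)
  have C: "0 \<le> C" using g0 Bpos by (simp add: C_def)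
  have E: "0 \<le> E" using y by (simp add: E_def)
  \<comment> \<open>The lag \<open>j + l - i\<close>, split so that it separates the two blocks under the Beta integral.\<close>
  define N where "N i l = b - 1 - i + l + (j - b + 1)" for i l
  have gN: "g (int i - int l - int j) = C * Beta (real (N i l) + d) y" if "i < b" for i l
  proof -
    have "int i - int l - int j = - int (N i l)" using that b by (simp add: N_def)
    then have "g (int i - int l - int j) = g (int (N i l))"
      using spectral_density_even[OF g] by simp
    then show ?thesis using fractional_coeff_Beta[OF d g] by (simp add: C_def y_def)
  qed
  have UV: "(\<Sum>i<b. \<Sum>l<b. u i * v l * (r powr (real (N i l) + d - 1) * (1 - r) powr (y - 1)))
      = w r * (U r * V r)" if "r \<in> {0..1}" for r
  proof -
    \<comment> \<open>The exponent splits into one part for each block and the common part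
      \<open>m + d\<close>; at \<open>r = 0\<close> both sides are 0 because
      \<open>0 powr a = 0\<close>.\<close>
    have "r powr (real (N i l) + d - 1) = r powr (m + d) * (r ^ (b - 1 - i) * r ^ l)" if "i < b" for i l
    proof (cases "r = 0")
      case False
      with \<open>r \<in> {0..1}\<close> have r: "0 < r" by simp
      have "real (N i l) + d - 1 = (m + d) + (real (b - 1 - i) + real l)"
        using b by (simp add: N_def m_def of_nat_diff)
      then show ?thesis using r by (simp only: powr_add powr_realpow)
    qed simp
    then have "(\<Sum>i<b. \<Sum>l<b. u i * v l * (r powr (real (N i l) + d - 1) * (1 - r) powr (y - 1)))
      = (\<Sum>i<b. \<Sum>l<b. w r * ((u i * r ^ (b - 1 - i)) * (v l * r ^ l)))"
      by (intro sum.cong refl) (simp add: w_def)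
    also have "\<dots> = w r * (U r * V r)"
      unfolding U_def V_def sum_product by (simp only: sum_distrib_left)
    finally show ?thesis .
  qed
  have "((\<lambda>r. \<Sum>i<b. \<Sum>l<b. u i * v l * (r powr (real (N i l) + d - 1) * (1 - r) powr (y - 1)))
     has_integral (\<Sum>i<b. \<Sum>l<b. u i * v l * Beta (real (N i l) + d) y)) {0..1}"
    using d y by (intro has_integral_sum has_integral_mult_right has_integral_Beta_real) auto
  then have hi: "((\<lambda>r. w r * (U r * V r)) has_integral
      (\<Sum>i<b. \<Sum>l<b. u i * v l * Beta (real (N i l) + d) y)) {0..1}"
    by (subst has_integral_cong[OF UV[symmetric]])
  have hw: "(w has_integral Beta (m + d + 1) y) {0..1}"
    using has_integral_Beta_real[of "m + d + 1" y] m d y by (simp add: w_def[abs_def])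
  have bound: "norm (w r * (U r * V r)) \<le> E * S * w r" if r: "r \<in> {0..1}" for r
  proof -
    have r': "0 \<le> r" "r \<le> 1" using r by auto
    have "(U r)\<^sup>2 \<le> E * toeplitz_form g b u u 0"
      using linear_functional_bound[OF d g b(1) trig_poly_geometric_reverse_bound[OF r'], of u]
      by (simp add: U_def E_def y_def)
    then have U: "\<bar>U r\<bar> \<le> sqrt E * sqrt (toeplitz_form g b u u 0)"
      using real_sqrt_le_mono by (fastforce simp: real_sqrt_mult)
    have "(V r)\<^sup>2 \<le> E * toeplitz_form g b v v 0"
      using linear_functional_bound[OF d g b(1) trig_poly_geometric_bound[OF r'], of v]
      by (simp add: V_def E_def y_def)
    then have V: "\<bar>V r\<bar> \<le> sqrt E * sqrt (toeplitz_form g b v v 0)"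
      using real_sqrt_le_mono by (fastforce simp: real_sqrt_mult)
    have "\<bar>U r\<bar> * \<bar>V r\<bar> \<le> (sqrt E * sqrt (toeplitz_form g b u u 0)) * (sqrt E * sqrt (toeplitz_form g b v v 0))"
      by (rule mult_mono[OF U V]) (use E toeplitz_form_nonneg[OF g] in auto)
    also have "\<dots> = (sqrt E * sqrt E) * S" by (simp only: S_def mult_ac)
    also have "\<dots> = E * S" using E by simp
    finally have "w r * (\<bar>U r\<bar> * \<bar>V r\<bar>) \<le> w r * (E * S)"
      by (rule mult_left_mono) (simp add: w_def)
    then show ?thesis by (simp add: abs_mult w_def mult_ac)
  qed
  have "toeplitz_form g b u v (int j) = C * (\<Sum>i<b. \<Sum>l<b. u i * v l * Beta (real (N i l) + d) y)"
    unfolding toeplitz_form_def sum_distrib_left by (intro sum.cong refl) (simp add: gN)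
  then have "\<bar>toeplitz_form g b u v (int j)\<bar> = C * norm (integral {0..1} (\<lambda>r. w r * (U r * V r)))"
    using C integral_unique[OF hi] by (simp add: abs_mult)
  also have "\<dots> \<le> C * integral {0..1} (\<lambda>r. E * S * w r)"
    by (intro mult_left_mono C integral_norm_bound_integral bound has_integral_integrable[OF hi]
        has_integral_integrable[OF has_integral_mult_right[OF hw]])
  also have "integral {0..1} (\<lambda>r. E * S * w r) = E * S * Beta (m + d + 1) y"
    by (intro integral_unique has_integral_mult_right hw)
  also have "Beta (m + d + 1) y \<le> 2 * Gamma y * m powr (- y)"
  proof -
    have "Beta (m + d + 1) y \<le> 2 * Gamma y * (m + d + 1) powr (- y)"
      by (rule Beta_le_powr) (use m d y in auto)
    also have "\<dots> \<le> 2 * Gamma y * m powr (- y)"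
      using m d y Gamma_real_pos[of y] by (intro mult_left_mono powr_mono2') auto
    finally show ?thesis .
  qed
  finally have le: "\<bar>toeplitz_form g b u v (int j)\<bar> \<le> C * (E * S * (2 * Gamma y * m powr (- y)))"
    using C E toeplitz_form_nonneg[OF g] by (simp add: S_def mult_left_mono)
  have "real b powr y * m powr (- y) = (real b / m) powr y"
    using m by (simp add: powr_divide powr_minus_divide)
  then have "C * (E * S * (2 * Gamma y * m powr (- y)))
    = C * (100 / y) * (2 * Gamma y) * (real b / m) powr y * S"
    by (simp add: E_def)
  with le show ?thesis by (simp add: C_def y_def S_def m_def)
qed

text \<open>Negative lags reduce to positive ones by exchanging the blocks. The bound decreases in
  the lag, so its value at \<open>q\<close> serves for all lags of modulus at least
  \<open>q\<close>.\<close>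

lemma fractional_toeplitz_decay:
  assumes d: "0 < d" "d < 1 / 2" and g: "spectral_density (fractional_density d) g"
  obtains C where "0 < C"
    "\<And>b q j u v. 1 \<le> b \<Longrightarrow> b < q \<Longrightarrow> int q \<le> \<bar>j\<bar> \<Longrightarrow> \<bar>toeplitz_form g b u v j\<bar> \<le>
      C * (real b / (real q - real b)) powr (1 - 2 * d)
        * (sqrt (toeplitz_form g b u u 0) * sqrt (toeplitz_form g b v v 0))"
proof -
  define C where "C = g 0 / Beta d (1 - 2 * d) * (100 / (1 - 2 * d)) * (2 * Gamma (1 - 2 * d))"
  \<comment> \<open>\<open>\<bar>C\<bar> + 1\<close> is positive without any inspection of the sign
    of \<open>C\<close>.\<close>
  have "\<bar>toeplitz_form g b u v j\<bar> \<le> (\<bar>C\<bar> + 1) * (real b / (real q - real b)) powr (1 - 2 * d)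
        * (sqrt (toeplitz_form g b u u 0) * sqrt (toeplitz_form g b v v 0))"
    if b: "1 \<le> b" "b < q" "int q \<le> \<bar>j\<bar>" for b q :: nat and j :: int and u v :: "nat \<Rightarrow> real"
  proof -
    define S where "S = sqrt (toeplitz_form g b u u 0) * sqrt (toeplitz_form g b v v 0)"
    have S: "0 \<le> S" using toeplitz_form_nonneg[OF g] by (simp add: S_def)
    define n where "n = nat \<bar>j\<bar>"
    have n: "b < n" "q \<le> n" using b by (auto simp: n_def)
    have "\<bar>toeplitz_form g b u v j\<bar> \<le> C * (real b / (real n - real b)) powr (1 - 2 * d) * S"
    proof (cases "0 \<le> j")
      case True
      then have "j = int n" by (simp add: n_def)
      then show ?thesis
        using fractional_toeplitz_decay_pos[OF d g b(1) n(1), of u v] by (simp add: C_def S_def)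
    next
      case False
      then have "toeplitz_form g b u v j = toeplitz_form g b v u (int n)"
        using toeplitz_form_minus[of g b u v "int n"] spectral_density_even[OF g] by (simp add: n_def)
      then show ?thesis
        using fractional_toeplitz_decay_pos[OF d g b(1) n(1), of v u]
        by (simp add: C_def S_def mult.commute)
    qed
    also have "\<dots> \<le> (\<bar>C\<bar> + 1) * (real b / (real q - real b)) powr (1 - 2 * d) * S"
      using b n d S by (intro mult_right_mono mult_mono powr_mono2 divide_left_mono) auto
    finally show ?thesis by (simp add: S_def)
  qed
  then show ?thesis using that[of "\<bar>C\<bar> + 1"] by auto
qed

section \<open>Products of densities and convolution of coefficients\<close>

text \<open>The convolution formula for the Fourier coefficients of \<open>\<phi> f\<close> is obtained without inverting the
  Fourier transform of f: it is clear for trigonometric polynomials \<open>\<phi>\<close> and survives dominated limits.\<close>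

definition parseval_weight :: "(real \<Rightarrow> real) \<Rightarrow> (int \<Rightarrow> real) \<Rightarrow> (real \<Rightarrow> real) \<Rightarrow> bool" where
  "parseval_weight f \<gamma> \<phi> \<longleftrightarrow> (\<forall>n.
     (LINT x|circle_measure. of_real (\<phi> x * f x) * cis (of_int n * x)) =
     1 / (2 * of_real pi) * (LINT m|count_space UNIV. of_real (\<gamma> m) *
        (LINT x|circle_measure. of_real (\<phi> x) * cis (of_int (n - m) * x))))"

text \<open>A squared modulus turns the left side into a Toeplitz form of \<open>\<gamma>\<close>
  and the inner integrals into Toeplitz forms of white noise, so that the series over
  \<open>m\<close> has only finitely many nonzero terms.\<close>

lemma parseval_weight_trig_poly:
  assumes f: "spectral_density f \<gamma>"
  shows "parseval_weight f \<gamma> (\<lambda>x. (cmod (trig_poly N u x))\<^sup>2)"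
  unfolding parseval_weight_def
proof
  fix n :: int
  define \<delta> :: "int \<Rightarrow> real" where "\<delta> n = (if n = 0 then 1 else 0)" for n
  have w: "spectral_density (\<lambda>_. 1 / (2 * pi)) \<delta>"
    using spectral_density_white_noise by (simp add: \<delta>_def[abs_def])
  have sq: "complex_of_real ((cmod (trig_poly N u x))\<^sup>2) = trig_poly N u x * cnj (trig_poly N u x)" for x
    by (rule complex_norm_square)
  have L: "(LINT x|circle_measure. of_real ((cmod (trig_poly N u x))\<^sup>2 * f x) * cis (of_int n * x))
      = of_real (toeplitz_form \<gamma> N u u (- n))"
    unfolding toeplitz_form_spectral[OF f] of_real_mult sq
    by (rule Bochner_Integration.integral_cong[OF refl]) simp
  have R: "(LINT x|circle_measure. of_real ((cmod (trig_poly N u x))\<^sup>2) * cis (of_int (n - m) * x))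
      = of_real (2 * pi) * of_real (toeplitz_form \<delta> N u u (m - n))" for m
  proof -
    have "of_real (2 * pi) * of_real (toeplitz_form \<delta> N u u (m - n))
      = (LINT x|circle_measure. of_real (2 * pi) * (of_real (1 / (2 * pi)) *
          (trig_poly N u x * cnj (trig_poly N u x) * cis (- of_int (m - n) * x))))"
      unfolding toeplitz_form_spectral[OF w] by simp
    also have "\<dots> = (LINT x|circle_measure. of_real ((cmod (trig_poly N u x))\<^sup>2) * cis (of_int (n - m) * x))"
      unfolding sq by (rule Bochner_Integration.integral_cong[OF refl]) simp
    finally show ?thesis by simp
  qed
  \<comment> \<open>Only \<open>m = i - l + n\<close> contributes to the pair
    \<open>(i, l)\<close>.\<close>
  have int1: "has_bochner_integral (count_space UNIV) (\<lambda>m. \<gamma> m * \<delta> (int i - int l - (m - n)))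
      (\<gamma> (int i - int l + n))" for i l
  proof -
    define k where "k = int i - int l + n"
    have "has_bochner_integral (count_space UNIV) (\<lambda>m. indicator {k} m *\<^sub>R \<gamma> k)
        (measure (count_space UNIV) {k} *\<^sub>R \<gamma> k)"
      by (rule has_bochner_integral_indicator) auto
    moreover have "indicator {k} m *\<^sub>R \<gamma> k = \<gamma> m * \<delta> (int i - int l - (m - n))" for m
      by (auto simp: \<delta>_def k_def indicator_def)
    ultimately show ?thesis by (simp add: k_def)
  qed
  have "has_bochner_integral (count_space UNIV)
      (\<lambda>m. \<Sum>i<N. \<Sum>l<N. u i * u l * (\<gamma> m * \<delta> (int i - int l - (m - n))))
      (\<Sum>i<N. \<Sum>l<N. u i * u l * \<gamma> (int i - int l + n))"
    by (intro has_bochner_integral_sum has_bochner_integral_mult_right int1)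
  also have "(\<lambda>m. \<Sum>i<N. \<Sum>l<N. u i * u l * (\<gamma> m * \<delta> (int i - int l - (m - n))))
      = (\<lambda>m. \<gamma> m * toeplitz_form \<delta> N u u (m - n))"
    by (simp add: toeplitz_form_def sum_distrib_left mult_ac)
  finally have "(LINT m|count_space UNIV. \<gamma> m * toeplitz_form \<delta> N u u (m - n)) = toeplitz_form \<gamma> N u u (- n)"
    by (simp add: has_bochner_integral_iff toeplitz_form_def)
  then have "(LINT m|count_space UNIV. complex_of_real (\<gamma> m * toeplitz_form \<delta> N u u (m - n)))
      = of_real (toeplitz_form \<gamma> N u u (- n))"
    by (simp only: integral_complex_of_real)
  moreover have "(LINT m|count_space UNIV. of_real (\<gamma> m) *
        (LINT x|circle_measure. of_real ((cmod (trig_poly N u x))\<^sup>2) * cis (of_int (n - m) * x)))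
     = (LINT m|count_space UNIV. of_real (2 * pi) * complex_of_real (\<gamma> m * toeplitz_form \<delta> N u u (m - n)))"
    unfolding R by (intro Bochner_Integration.integral_cong refl) simp
  ultimately show "(LINT x|circle_measure. of_real ((cmod (trig_poly N u x))\<^sup>2 * f x) * cis (of_int n * x))
    = 1 / (2 * of_real pi) * (LINT m|count_space UNIV. of_real (\<gamma> m) *
        (LINT x|circle_measure. of_real ((cmod (trig_poly N u x))\<^sup>2) * cis (of_int (n - m) * x)))"
    unfolding L by simp
qed

text \<open>Dominated convergence is applied three times: to the integral against \<open>f\<close>,
  to each Fourier coefficient of the weight, and to the series in \<open>m\<close>, where the
  integral of \<open>w\<close> bounds all coefficients at once. The origin is left out because the
  intended limit is singular there.\<close>

lemma parseval_weight_limit: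
  assumes f: "spectral_density f \<gamma>" and sum: "integrable (count_space UNIV) \<gamma>"
    and P: "\<And>N. parseval_weight f \<gamma> (\<phi> N)"
    and meas: "\<And>N. \<phi> N \<in> borel_measurable borel" "\<psi> \<in> borel_measurable borel"
    and lim: "\<And>x. x \<in> {-pi<..pi} \<Longrightarrow> x \<noteq> 0 \<Longrightarrow> (\<lambda>N. \<phi> N x) \<longlonglongrightarrow> \<psi> x"
    and dom: "\<And>N x. x \<in> {-pi<..pi} \<Longrightarrow> x \<noteq> 0 \<Longrightarrow> \<bar>\<phi> N x\<bar> \<le> w x"
    and w: "integrable circle_measure w" "integrable circle_measure (\<lambda>x. w x * f x)"
  shows "parseval_weight f \<gamma> \<psi>"
  unfolding parseval_weight_def
proof
  fix n :: int
  note [measurable] = borel_measurable_circle[OF meas(1)] borel_measurable_circle[OF meas(2)]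
    borel_measurable_circle[OF cis_mult_measurable]
    borel_measurable_integrable[OF spectral_density_integrable[OF f]]
  have AE: "AE x in circle_measure. Q x" if "\<And>x. x \<in> {-pi<..pi} \<Longrightarrow> x \<noteq> 0 \<Longrightarrow> Q x" for Q
    by (rule AE_mp[OF AE_circle_nonzero]) (use that in \<open>auto intro!: AE_I2 simp: space_circle\<close>)
  define I where "I N m = (LINT x|circle_measure. of_real (\<phi> N x) * cis (of_int (n - m) * x))" for N m
  define J where "J m = (LINT x|circle_measure. of_real (\<psi> x) * cis (of_int (n - m) * x))" for m
  have L: "(\<lambda>N. LINT x|circle_measure. of_real (\<phi> N x * f x) * cis (of_int n * x))
     \<longlonglongrightarrow> (LINT x|circle_measure. of_real (\<psi> x * f x) * cis (of_int n * x))"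
  proof (rule integral_dominated_convergence[where w = "\<lambda>x. w x * f x"])
    show "AE x in circle_measure. (\<lambda>N. of_real (\<phi> N x * f x) * cis (of_int n * x))
        \<longlonglongrightarrow> of_real (\<psi> x * f x) * cis (of_int n * x)"
      by (rule AE) (intro tendsto_intros lim)
    show "AE x in circle_measure. norm (of_real (\<phi> N x * f x) * cis (of_int n * x)) \<le> w x * f x" for N
      by (rule AE) (use dom spectral_density_nonneg[OF f] in \<open>simp add: norm_mult mult_right_mono\<close>)
  qed (use w in measurable)
  have IJ: "(\<lambda>N. I N m) \<longlonglongrightarrow> J m" for m
    unfolding I_def J_def
  proof (rule integral_dominated_convergence[where w = w])
    show "AE x in circle_measure. (\<lambda>N. of_real (\<phi> N x) * cis (of_int (n - m) * x))
        \<longlonglongrightarrow> of_real (\<psi> x) * cis (of_int (n - m) * x)"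
      by (rule AE) (intro tendsto_intros lim)
    show "AE x in circle_measure. norm (of_real (\<phi> N x) * cis (of_int (n - m) * x)) \<le> w x" for N
      by (rule AE) (use dom in \<open>simp add: norm_mult\<close>)
  qed (use w in measurable)
  have Ib: "cmod (I N m) \<le> (LINT x|circle_measure. w x)" for N m
    unfolding I_def
  proof (rule order_trans[OF integral_norm_bound], rule integral_mono_AE')
    show "AE x in circle_measure. norm (of_real (\<phi> N x) * cis (of_int (n - m) * x)) \<le> w x"
      by (rule AE) (use dom in \<open>simp add: norm_mult\<close>)
    show "AE x in circle_measure. 0 \<le> w x"
      by (rule AE) (use dom[of _ 0] in \<open>fastforce intro: order_trans[OF abs_ge_zero]\<close>)
  qed (rule w)
  have "(\<lambda>N. LINT m|count_space UNIV. of_real (\<gamma> m) * I N m)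
     \<longlonglongrightarrow> (LINT m|count_space UNIV. of_real (\<gamma> m) * J m)"
  proof (rule integral_dominated_convergence[where w = "\<lambda>m. \<bar>\<gamma> m\<bar> * (LINT x|circle_measure. w x)"])
    show "integrable (count_space UNIV) (\<lambda>m. \<bar>\<gamma> m\<bar> * (LINT x|circle_measure. w x))" using sum by simp
    show "AE m in count_space UNIV. (\<lambda>N. of_real (\<gamma> m) * I N m) \<longlonglongrightarrow> of_real (\<gamma> m) * J m"
      by (intro AE_I2 tendsto_intros IJ)
    show "AE m in count_space UNIV. norm (of_real (\<gamma> m) * I N m) \<le> \<bar>\<gamma> m\<bar> * (LINT x|circle_measure. w x)" for N
      by (intro AE_I2) (simp add: norm_mult Ib mult_left_mono)
  qed auto
  then have "(\<lambda>N. 1 / (2 * of_real pi) * (LINT m|count_space UNIV. of_real (\<gamma> m) * I N m))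
     \<longlonglongrightarrow> 1 / (2 * of_real pi) * (LINT m|count_space UNIV. of_real (\<gamma> m) * J m)"
    by (intro tendsto_intros)
  moreover have "1 / (2 * of_real pi) * (LINT m|count_space UNIV. of_real (\<gamma> m) * I N m)
     = (LINT x|circle_measure. of_real (\<phi> N x * f x) * cis (of_int n * x))" for N
    using P[of N] unfolding parseval_weight_def I_def by simp
  ultimately have "(\<lambda>N. LINT x|circle_measure. of_real (\<phi> N x * f x) * cis (of_int n * x))
     \<longlonglongrightarrow> 1 / (2 * of_real pi) * (LINT m|count_space UNIV. of_real (\<gamma> m) * J m)" by simp
  from LIMSEQ_unique[OF L this]
  show "(LINT x|circle_measure. of_real (\<psi> x * f x) * cis (of_int n * x)) =
     1 / (2 * of_real pi) * (LINT m|count_space UNIV. of_real (\<gamma> m) *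
        (LINT x|circle_measure. of_real (\<psi> x) * cis (of_int (n - m) * x)))"
    by (simp only: J_def)
qed

lemma of_real_gbinomial: "complex_of_real (a gchoose n) = of_real a gchoose n"
  by (simp add: gbinomial_prod_rev)

text \<open>For a radius below 1 the binomial series of \<open>(1 - s * cis x) powr (- d)\<close>
  converges absolutely. Its partial sums are trigonometric polynomials with a common bound, and
  their squared moduli tend to the power \<open>- 2 * d\<close> of the modulus.\<close>

lemma parseval_weight_abel:
  assumes f: "spectral_density f \<gamma>" and sum: "integrable (count_space UNIV) \<gamma>"
    and s: "0 < s" "s < 1"
  shows "parseval_weight f \<gamma> (\<lambda>x. cmod (1 - of_real s * cis x) powr (- 2 * d))"
proof -
  define u where "u k = ((- d) gchoose k) * (- s) ^ k" for k
  have conv: "(\<lambda>N. trig_poly N u x) \<longlonglongrightarrow> (1 - of_real s * cis x) powr of_real (- d)" for x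
  proof -
    have "cmod (- (of_real s * cis x)) < 1" using s by (simp add: norm_mult)
    from gen_binomial_complex[OF this, of "of_real (- d)"]
    have "(\<lambda>n. (of_real (- d) gchoose n) * (- (of_real s * cis x)) ^ n)
        sums (1 - of_real s * cis x) powr of_real (- d)" by simp
    moreover have "(of_real (- d) gchoose n) * (- (of_real s * cis x)) ^ n
        = of_real (u n) * cis (real n * x)" for n
    proof -
      have "(- (of_real s * cis x)) ^ n = complex_of_real ((- s) ^ n) * cis (real n * x)"
        by (simp add: Complex.DeMoivre[symmetric] power_mult_distrib[symmetric])
      then show ?thesis by (simp only: u_def of_real_mult of_real_gbinomial mult.assoc)
    qed
    ultimately show ?thesis unfolding sums_def trig_poly_def by simp
  qed
  have "summable (\<lambda>k. \<bar>u k\<bar>)"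
  proof -
    \<comment> \<open>A radius strictly between s and 1 turns convergence into absolute convergence.\<close>
    define t where "t = (1 + s) / 2"
    have t: "\<bar>t\<bar> < 1" "s < t" using s by (auto simp: t_def)
    have "summable (\<lambda>n. ((- d) gchoose n) * t ^ n)"
      using gen_binomial_real[OF t(1), of "- d"] by (rule sums_summable)
    from powser_insidea[OF this, of "- s"] show ?thesis using s t by (simp add: u_def)
  qed
  then have ub: "(\<Sum>k<N. \<bar>u k\<bar>) \<le> (\<Sum>k. \<bar>u k\<bar>)" for N by (rule sum_le_suminf) auto
  note [measurable] = trig_poly_measurable
  have cm: "cis \<in> borel_measurable borel" using cis_mult_measurable[of 1] by simp
  show ?thesis
  proof (rule parseval_weight_limit[OF f sum, where \<phi> = "\<lambda>N x. (cmod (trig_poly N u x))\<^sup>2"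
        and w = "\<lambda>_. (\<Sum>k. \<bar>u k\<bar>)\<^sup>2"])
    show "parseval_weight f \<gamma> (\<lambda>x. (cmod (trig_poly N u x))\<^sup>2)" for N
      by (rule parseval_weight_trig_poly[OF f])
    show "(\<lambda>x. (cmod (trig_poly N u x))\<^sup>2) \<in> borel_measurable borel" for N by measurable
    show "(\<lambda>x. cmod (1 - complex_of_real s * cis x) powr (- 2 * d)) \<in> borel_measurable borel"
      using cm by measurable
    show "(\<lambda>N. (cmod (trig_poly N u x))\<^sup>2) \<longlonglongrightarrow> cmod (1 - of_real s * cis x) powr (- 2 * d)" for x
    proof -
      have "(\<lambda>N. (cmod (trig_poly N u x))\<^sup>2)
          \<longlonglongrightarrow> (cmod ((1 - of_real s * cis x) powr of_real (- d)))\<^sup>2"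
        by (intro tendsto_intros conv)
      also have "cmod ((1 - of_real s * cis x) powr of_real (- d)) = cmod (1 - of_real s * cis x) powr (- d)"
        by (subst norm_powr_real_powr') auto
      also have "\<dots>\<^sup>2 = cmod (1 - of_real s * cis x) powr (- 2 * d)"
        by (simp add: power2_eq_square powr_add[symmetric])
      finally show ?thesis .
    qed
    show "\<bar>(cmod (trig_poly N u x))\<^sup>2\<bar> \<le> (\<Sum>k. \<bar>u k\<bar>)\<^sup>2" for N x
      using order_trans[OF norm_trig_poly_le ub] by (simp add: power_mono)
    show "integrable circle_measure (\<lambda>_. (\<Sum>k. \<bar>u k\<bar>)\<^sup>2)"
      by (rule finite_measure.integrable_const[OF finite_measure_circle])
    show "integrable circle_measure (\<lambda>x. (\<Sum>k. \<bar>u k\<bar>)\<^sup>2 * f x)"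
      using spectral_density_integrable[OF f] by simp
  qed
qed

text \<open>Abel summation: the convolution formula holds for each radius below 1, and the radial
  comparison dominates all these weights by a multiple of the fractional density, which is
  integrable by itself and against \<open>f\<^sub>0\<close>.\<close>

lemma fractional_convolution:
  assumes d: "0 < d"
    and f: "spectral_density (\<lambda>x. fractional_density d x * f\<^sub>0 x) \<gamma>"
    and f0: "spectral_density f\<^sub>0 \<gamma>\<^sub>0"
    and g: "spectral_density (fractional_density d) g"
    and sum: "integrable (count_space UNIV) \<gamma>\<^sub>0"
  shows "\<gamma> n = 1 / (2 * pi) * (LINT m|count_space UNIV. \<gamma>\<^sub>0 m * g (n - m))"
proof -
  define s where "s N = 1 - 1 / real (N + 2)" for N
  have s: "0 < s N" "s N < 1" for N by (auto simp: s_def)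
  have slim: "s \<longlonglongrightarrow> 1" unfolding s_def by real_asymp
  \<comment> \<open>\<open>2 powr (2 * d)\<close> is the price of the radial comparison;
    \<open>2 * pi\<close> cancels the normalisation of the density.\<close>
  define w where "w x = 2 powr (2 * d) * (2 * pi) * fractional_density d x" for x
  have cm: "cis \<in> borel_measurable borel" using cis_mult_measurable[of 1] by simp
  have pw: "parseval_weight f\<^sub>0 \<gamma>\<^sub>0 (\<lambda>x. 2 * pi * fractional_density d x)"
  proof (rule parseval_weight_limit[OF f0 sum,
        where \<phi> = "\<lambda>N x. cmod (1 - of_real (s N) * cis x) powr (- 2 * d)" and w = w])
    show "parseval_weight f\<^sub>0 \<gamma>\<^sub>0 (\<lambda>x. cmod (1 - of_real (s N) * cis x) powr (- 2 * d))" for N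
      by (rule parseval_weight_abel[OF f0 sum s])
    show "(\<lambda>x. cmod (1 - complex_of_real (s N) * cis x) powr (- 2 * d)) \<in> borel_measurable borel" for N
      using cm by measurable
    show "(\<lambda>x. 2 * pi * fractional_density d x) \<in> borel_measurable borel"
      using fractional_density_measurable by measurable
    fix x :: real assume x: "x \<in> {-pi<..pi}" "x \<noteq> 0"
    have y: "0 < cmod (1 - cis x)" using abs_le_norm_one_minus_cis[of x] x by auto
    have "(\<lambda>N. cmod (1 - of_real (s N) * cis x) powr (- 2 * d))
        \<longlonglongrightarrow> cmod (1 - of_real 1 * cis x) powr (- 2 * d)"
      using y by (intro tendsto_intros slim) auto
    then show "(\<lambda>N. cmod (1 - of_real (s N) * cis x) powr (- 2 * d)) \<longlonglongrightarrow> 2 * pi * fractional_density d x"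
      by (simp add: fractional_density_eq)
    fix N
    have "cmod (1 - cis x) / 2 \<le> cmod (1 - of_real (s N) * cis x)"
      using norm_one_minus_le_radial[of "s N" "cis x"] s[of N] by simp
    then have "cmod (1 - of_real (s N) * cis x) powr (- 2 * d) \<le> (cmod (1 - cis x) / 2) powr (- 2 * d)"
      using y d by (intro powr_mono2') auto
    also have "\<dots> = w x"
      by (simp add: w_def fractional_density_eq powr_divide powr_minus field_simps)
    finally show "\<bar>cmod (1 - of_real (s N) * cis x) powr (- 2 * d)\<bar> \<le> w x" by simp
  next
    show "integrable circle_measure w"
      unfolding w_def[abs_def] using spectral_density_integrable[OF g] by simp
    show "integrable circle_measure (\<lambda>x. w x * f\<^sub>0 x)"
      unfolding w_def[abs_def] using spectral_density_integrable[OF f] by (simp add: mult.assoc)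
  qed
  have "of_real (2 * pi) * complex_of_real (\<gamma> n)
      = (LINT x|circle_measure. of_real (2 * pi * fractional_density d x * f\<^sub>0 x) * cis (of_int n * x))"
    unfolding spectral_density_coeff[OF f] by (simp add: mult.assoc)
  also have "\<dots> = 1 / (2 * of_real pi) * (LINT m|count_space UNIV. of_real (\<gamma>\<^sub>0 m) *
        (LINT x|circle_measure. of_real (2 * pi * fractional_density d x) * cis (of_int (n - m) * x)))"
    using pw unfolding parseval_weight_def by blast
  also have "(\<lambda>m. LINT x|circle_measure. of_real (2 * pi * fractional_density d x) * cis (of_int (n - m) * x))
      = (\<lambda>m. of_real (2 * pi) * of_real (g (n - m)))"
    unfolding spectral_density_coeff[OF g] by (simp add: mult.assoc)
  also have "(LINT m|count_space UNIV. complex_of_real (\<gamma>\<^sub>0 m) * (of_real (2 * pi) * of_real (g (n - m))))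
      = (LINT m|count_space UNIV. of_real (2 * pi) * complex_of_real (\<gamma>\<^sub>0 m * g (n - m)))"
    by (intro Bochner_Integration.integral_cong refl) simp
  also have "\<dots> = of_real (2 * pi) * complex_of_real (LINT m|count_space UNIV. \<gamma>\<^sub>0 m * g (n - m))"
    by (simp only: integral_mult_right_zero integral_complex_of_real)
  finally have "of_real (2 * pi) * complex_of_real (\<gamma> n)
     = of_real (2 * pi) * complex_of_real (1 / (2 * pi) * (LINT m|count_space UNIV. \<gamma>\<^sub>0 m * g (n - m)))"
    by simp
  then have "complex_of_real (\<gamma> n) =
      complex_of_real (1 / (2 * pi) * (LINT m|count_space UNIV. \<gamma>\<^sub>0 m * g (n - m)))"
    by (rule mult_left_cancel[THEN iffD1, rotated]) simp
  then show ?thesis by (simp only: of_real_eq_iff)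
qed

section \<open>Canonical correlations\<close>

text \<open>The Cauchy-Schwarz bound for blocks of length one.\<close>

lemma spectral_density_abs_le:
  assumes "spectral_density f \<gamma>"
  shows "\<bar>\<gamma> n\<bar> \<le> \<gamma> 0"
  using toeplitz_form_le_sqrt[OF assms, of 1 "\<lambda>_. 1" "\<lambda>_. 1" "-n"]
    toeplitz_form_nonneg[OF assms, of 1 "\<lambda>_. 1"]
  by (simp add: toeplitz_form_def)

text \<open>After centring, the product of the finite sums expands term by term, and stationarity
  reduces each term to a time difference; the offset 1 of both blocks cancels.\<close>

lemma covariance_block_combination:
  assumes prob: "prob_space M" and Z: "second_order_stationary M Z"
    and u: "u \<in> carrier_vec b" and v: "v \<in> carrier_vec b"
  shows "covariance M (block_combination Z k u) (block_combination Z l v)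
    = toeplitz_form (covariance_function M Z) b (vec_index u) (vec_index v) (int l - int k)"
proof -
  interpret prob_space M by (rule prob)
  have [measurable]: "Z n \<in> borel_measurable M" and sq: "integrable M (\<lambda>\<omega>. (Z n \<omega>)\<^sup>2)" for n
    using Z by (auto simp: second_order_stationary_def)
  have int: "integrable M (Z n)" for n by (rule square_integrable_imp_integrable[OF _ sq]) simp
  define Y where "Y n \<omega> = Z n \<omega> - (LINT \<omega>'|M. Z n \<omega>')" for n \<omega>
  have [measurable]: "Y n \<in> borel_measurable M" for n unfolding Y_def[abs_def] by measurable
  have Ysq: "integrable M (\<lambda>\<omega>. (Y n \<omega>)\<^sup>2)" for n
  proof -
    have "integrable M (\<lambda>\<omega>. (Z n \<omega>)\<^sup>2 - 2 * (LINT \<omega>'|M. Z n \<omega>') * Z n \<omega> + (LINT \<omega>'|M. Z n \<omega>')\<^sup>2)"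
      using sq int by simp
    then show ?thesis by (simp add: Y_def power2_eq_square algebra_simps)
  qed
  have YY: "integrable M (\<lambda>\<omega>. Y m \<omega> * Y n \<omega>)" for m n
    by (rule integral_Cauchy_Schwarz(1)) (simp_all add: Ysq)
  have cov: "(LINT \<omega>|M. Y m \<omega> * Y n \<omega>) = covariance_function M Z (m - n)" for m n
  proof -
    have "covariance M (Z (m - n + n)) (Z (0 + n)) = covariance M (Z (m - n)) (Z 0)"
      using Z unfolding second_order_stationary_def by blast
    then show ?thesis by (simp add: covariance_function_def covariance_def Y_def)
  qed
  have centre: "block_combination Z k w \<omega> - (LINT \<omega>'|M. block_combination Z k w \<omega>')
      = (\<Sum>j<b. vec_index w j * Y (int k + int j + 1) \<omega>)" if "w \<in> carrier_vec b" for w k \<omega>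
    using that int by (simp add: block_combination_def Y_def right_diff_distrib sum_subtractf)
  have "covariance M (block_combination Z k u) (block_combination Z l v)
     = (LINT \<omega>|M. (\<Sum>i<b. \<Sum>j<b. vec_index u i * vec_index v j *
          (Y (int k + int i + 1) \<omega> * Y (int l + int j + 1) \<omega>)))"
    unfolding covariance_def centre[OF u] centre[OF v] sum_product by (simp add: mult_ac)
  also have "\<dots> = (\<Sum>i<b. \<Sum>j<b. vec_index u i * vec_index v j *
      covariance_function M Z ((int k + int i + 1) - (int l + int j + 1)))"
    using YY by (simp add: Bochner_Integration.integral_sum cov)
  also have "\<dots> = toeplitz_form (covariance_function M Z) b (vec_index u) (vec_index v) (int l - int k)"
    unfolding toeplitz_form_def by (intro sum.cong refl) (simp add: algebra_simps)
  finally show ?thesis .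
qed

text \<open>Turns a bound on forms into a bound on the supremum, whose index set is nonempty since
  \<open>1 \<le> b\<close> provides a nonzero vector.\<close>

lemma canonical_correlation_le:
  assumes prob: "prob_space M" and Z: "second_order_stationary M Z" and b: "1 \<le> b" and B: "0 \<le> B"
    and nonneg: "\<And>u. 0 \<le> toeplitz_form (covariance_function M Z) b u u 0"
    and bound: "\<And>u v. toeplitz_form (covariance_function M Z) b u v (int k) \<le>
      B * (sqrt (toeplitz_form (covariance_function M Z) b u u 0)
         * sqrt (toeplitz_form (covariance_function M Z) b v v 0))"
  shows "canonical_correlation M Z k b \<le> B"
  unfolding canonical_correlation_def
proof (rule cSup_least)
  define e :: "real Matrix.vec" where "e = Matrix.vec b (\<lambda>_. 1)"
  have "vec_index e 0 \<noteq> vec_index (0\<^sub>v b :: real Matrix.vec) 0" using b by (simp add: e_def)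
  then have "e \<in> carrier_vec b" "e \<noteq> 0\<^sub>v b" by (auto simp: e_def)
  then show "{correlation M (block_combination Z 0 u) (block_combination Z k v) |u v.
      u \<in> carrier_vec b \<and> v \<in> carrier_vec b \<and> u \<noteq> 0\<^sub>v b \<and> v \<noteq> 0\<^sub>v b} \<noteq> {}" by blast
next
  fix x assume "x \<in> {correlation M (block_combination Z 0 u) (block_combination Z k v) |u v.
      u \<in> carrier_vec b \<and> v \<in> carrier_vec b \<and> u \<noteq> 0\<^sub>v b \<and> v \<noteq> 0\<^sub>v b}"
  then obtain u v where u: "u \<in> carrier_vec b" and v: "v \<in> carrier_vec b"
    and x: "x = correlation M (block_combination Z 0 u) (block_combination Z k v)" by blast
  define S where "S = sqrt (toeplitz_form (covariance_function M Z) b (vec_index u) (vec_index u) 0)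
    * sqrt (toeplitz_form (covariance_function M Z) b (vec_index v) (vec_index v) 0)"
  have "x = toeplitz_form (covariance_function M Z) b (vec_index u) (vec_index v) (int k) / S"
    using covariance_block_combination[OF prob Z u v, of 0 k]
      covariance_block_combination[OF prob Z u u, of 0 0]
      covariance_block_combination[OF prob Z v v, of k k]
    by (simp add: x correlation_def S_def)
  moreover have "0 \<le> S" using nonneg by (simp add: S_def)
  \<comment> \<open>When a variance vanishes the quotient is 0 by convention, and
    \<open>0 \<le> B\<close> covers that case.\<close>
  ultimately show "x \<le> B"
    using bound[of "vec_index u" "vec_index v", folded S_def] B
    by (cases "S = 0") (simp_all add: pos_divide_le_eq)
qed

text \<open>A shift of the argument by \<open>m\<close> is a shift of the lag by \<open>m\<close>,
  and the finite sums over \<open>i\<close> and \<open>l\<close> commute with the series.\<close>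

lemma toeplitz_form_convolution:
  assumes conv: "\<And>n. \<gamma> n = c * (LINT m|count_space UNIV. \<gamma>\<^sub>0 m * g (n - m))"
    and int: "\<And>n. integrable (count_space UNIV) (\<lambda>m. \<gamma>\<^sub>0 m * g (n - m))"
  shows "integrable (count_space UNIV) (\<lambda>m. \<gamma>\<^sub>0 m * toeplitz_form g b u v (j + m))"
    and "toeplitz_form \<gamma> b u v j = c * (LINT m|count_space UNIV. \<gamma>\<^sub>0 m * toeplitz_form g b u v (j + m))"
proof -
  have eq: "\<gamma>\<^sub>0 m * toeplitz_form g b u v (j + m)
      = (\<Sum>i<b. \<Sum>l<b. u i * v l * (\<gamma>\<^sub>0 m * g (int i - int l - j - m)))" for m
    unfolding toeplitz_form_def sum_distrib_left
    by (intro sum.cong refl) (simp add: algebra_simps)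
  show "integrable (count_space UNIV) (\<lambda>m. \<gamma>\<^sub>0 m * toeplitz_form g b u v (j + m))"
    unfolding eq using int by simp
  show "toeplitz_form \<gamma> b u v j = c * (LINT m|count_space UNIV. \<gamma>\<^sub>0 m * toeplitz_form g b u v (j + m))"
  proof -
    have "(LINT m|count_space UNIV. \<gamma>\<^sub>0 m * toeplitz_form g b u v (j + m))
      = (\<Sum>i<b. \<Sum>l<b. u i * v l * (LINT m|count_space UNIV. \<gamma>\<^sub>0 m * g (int i - int l - j - m)))"
      unfolding eq using int by (simp add: Bochner_Integration.integral_sum)
    then show ?thesis by (simp add: toeplitz_form_def conv sum_distrib_left mult_ac)
  qed
qed

text \<open>The common source of all three rates: \<open>R\<close> is any bound for
  \<open>\<gamma>\<^sub>0\<close> beyond \<open>k - q\<close>, left open so that each decay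
  hypothesis can supply its own.\<close>

lemma canonical_correlation_tail_bound:
  assumes d: "0 < d" "d < 1 / 2"
    and prob: "prob_space M" and Z: "second_order_stationary M Z"
    and density: "spectral_density (\<lambda>x. fractional_density d x * f\<^sub>0 x) (covariance_function M Z)"
    and density0: "spectral_density f\<^sub>0 \<gamma>\<^sub>0"
    and inf: "(INF x\<in>{-pi<..pi}. f\<^sub>0 x) > 0"
    and summable: "(\<lambda>n. \<bar>\<gamma>\<^sub>0 n\<bar>) summable_on UNIV"
  obtains c\<^sub>1 c\<^sub>2 where "0 < c\<^sub>1" "0 < c\<^sub>2"
    "\<And>b q k R. 1 \<le> b \<Longrightarrow> b < q \<Longrightarrow> q < k \<Longrightarrow> (\<And>n. k - q < n \<Longrightarrow> \<bar>\<gamma>\<^sub>0 (int n)\<bar> \<le> R) \<Longrightarrow>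
      canonical_correlation M Z k b
        \<le> c\<^sub>1 * (real b / (real q - real b)) powr (1 - 2 * d) + c\<^sub>2 * real q * R"
proof -
  define c0 where "c0 = (INF x\<in>{-pi<..pi}. f\<^sub>0 x)"
  have c0: "0 < c0" using inf by (simp add: c0_def)
  \<comment> \<open>Nonnegativity of \<open>f\<^sub>0\<close> bounds the image below, so the infimum
    is a true lower bound.\<close>
  have f0: "c0 \<le> f\<^sub>0 x" if "x \<in> {-pi<..pi}" for x
    unfolding c0_def using spectral_density_nonneg[OF density0]
    by (intro cINF_lower that bdd_belowI[of _ 0]) auto
  \<comment> \<open>Dividing by the lower bound \<open>c0\<close> makes the integrable product
    dominate the fractional density, which secures the existence of \<open>g\<close>.\<close>
  have "integrable circle_measure (fractional_density d)"
  proof (rule Bochner_Integration.integrable_bound)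
    show "integrable circle_measure (\<lambda>x. 1 / c0 * (fractional_density d x * f\<^sub>0 x))"
      using spectral_density_integrable[OF density] by simp
    show "fractional_density d \<in> borel_measurable circle_measure"
      by (rule borel_measurable_circle[OF fractional_density_measurable])
    show "AE x in circle_measure. norm (fractional_density d x)
        \<le> norm (1 / c0 * (fractional_density d x * f\<^sub>0 x))"
    proof (rule AE_I2)
      fix x assume "x \<in> space circle_measure"
      then have "c0 \<le> f\<^sub>0 x" using f0 space_circle by auto
      then have "fractional_density d x * 1 \<le> fractional_density d x * (f\<^sub>0 x / c0)"
        using c0 fractional_density_nonneg by (intro mult_left_mono) auto
      moreover have "0 \<le> f\<^sub>0 x" using c0 \<open>c0 \<le> f\<^sub>0 x\<close> by simp
      ultimately show "norm (fractional_density d x) \<le> norm (1 / c0 * (fractional_density d x * f\<^sub>0 x))"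
        using c0 fractional_density_nonneg[of d x] by (simp add: abs_mult)
    qed
  qed
  from spectral_density_fractional[OF this] obtain g
    where g: "spectral_density (fractional_density d) g" by blast
  define \<gamma> where "\<gamma> = covariance_function M Z"
  have f: "spectral_density (\<lambda>x. fractional_density d x * f\<^sub>0 x) \<gamma>" using density by (simp add: \<gamma>_def)
  have sum: "integrable (count_space UNIV) \<gamma>\<^sub>0"
    using summable abs_summable_equivalent[of \<gamma>\<^sub>0 UNIV] by (simp add: abs_summable_on_def)
  define A where "A = (LINT m|count_space UNIV. \<bar>\<gamma>\<^sub>0 m\<bar>)"
  have A: "0 \<le> A" by (simp add: A_def)
  have int: "integrable (count_space UNIV) (\<lambda>m. \<gamma>\<^sub>0 m * g (n - m))" for n
  proof (rule Bochner_Integration.integrable_bound)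
    show "integrable (count_space UNIV) (\<lambda>m. \<gamma>\<^sub>0 m * g 0)" using sum by simp
    show "AE m in count_space UNIV. norm (\<gamma>\<^sub>0 m * g (n - m)) \<le> norm (\<gamma>\<^sub>0 m * g 0)"
      using spectral_density_abs_le[OF g] by (intro AE_I2) (auto simp: abs_mult intro!: mult_left_mono intro: order_trans[OF _ abs_ge_self])
  qed simp
  note conv = toeplitz_form_convolution[OF fractional_convolution[OF d(1) f density0 g sum] int]
  obtain C where C: "0 < C" and decay:
    "\<And>b q j u v. 1 \<le> b \<Longrightarrow> b < q \<Longrightarrow> int q \<le> \<bar>j\<bar> \<Longrightarrow> \<bar>toeplitz_form g b u v j\<bar> \<le>
      C * (real b / (real q - real b)) powr (1 - 2 * d)
        * (sqrt (toeplitz_form g b u u 0) * sqrt (toeplitz_form g b v v 0))"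
    using fractional_toeplitz_decay[OF d g] by blast
  have main: "canonical_correlation M Z k b \<le> (A * C / (2 * pi * c0) + 1) *
      (real b / (real q - real b)) powr (1 - 2 * d) + 1 / (pi * c0) * real q * R"
    if b: "1 \<le> b" "b < q" "q < k" and R: "\<And>n. k - q < n \<Longrightarrow> \<bar>\<gamma>\<^sub>0 (int n)\<bar> \<le> R" for b q k R
  proof -
    define X where "X = (real b / (real q - real b)) powr (1 - 2 * d)"
    have X: "0 \<le> X" by (simp add: X_def)
    have "0 \<le> R" using R[of k] b abs_ge_zero[of "\<gamma>\<^sub>0 (int k)"] by linarith
    \<comment> \<open>The fewer than \<open>2 q\<close> lags that are too short for the decay estimate all carry a small \<open>\<gamma>\<^sub>0 m\<close>.\<close>
    define T where "T = {m. \<bar>int k + m\<bar> < int q}"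
    have Teq: "T = {- int k - int q + 1 .. - int k + int q - 1}" by (auto simp: T_def)
    then have T: "finite T" "real (card T) \<le> 2 * real q" by auto
    \<comment> \<open>The first summand collects the long lags, the second the short ones;
      \<open>2 * pi\<close> stems from the convolution and \<open>c0\<close> from comparing
      variances.\<close>
    define B where "B = (A * (C * X) + 2 * real q * R) / (2 * pi * c0)"
    have B: "0 \<le> B" using A C X \<open>0 \<le> R\<close> c0 by (simp add: B_def)
    have "canonical_correlation M Z k b \<le> B"
    proof (rule canonical_correlation_le[OF prob Z b(1) B, folded \<gamma>_def])
      show "0 \<le> toeplitz_form \<gamma> b u u 0" for u by (rule toeplitz_form_nonneg[OF f])
      fix u v :: "nat \<Rightarrow> real"
      define S where "S = sqrt (toeplitz_form g b u u 0) * sqrt (toeplitz_form g b v v 0)"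
      define S' where "S' = sqrt (toeplitz_form \<gamma> b u u 0) * sqrt (toeplitz_form \<gamma> b v v 0)"
      have S: "0 \<le> S" using toeplitz_form_nonneg[OF g] by (simp add: S_def)
      have SS': "c0 * S \<le> S'"
      proof -
        have "sqrt (c0 * toeplitz_form g b w w 0) \<le> sqrt (toeplitz_form \<gamma> b w w 0)" for w
          using toeplitz_form_mono[OF f g f0] by simp
        then have "sqrt (c0 * toeplitz_form g b u u 0) * sqrt (c0 * toeplitz_form g b v v 0) \<le> S'"
          unfolding S'_def using c0 toeplitz_form_nonneg[OF g] toeplitz_form_nonneg[OF f]
          by (intro mult_mono) auto
        moreover have "sqrt (c0 * toeplitz_form g b u u 0) * sqrt (c0 * toeplitz_form g b v v 0)
            = (sqrt c0 * sqrt c0) * S" by (simp only: S_def real_sqrt_mult mult_ac)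
        ultimately show ?thesis using c0 by simp
      qed
      have pt: "norm (\<gamma>\<^sub>0 m * toeplitz_form g b u v (int k + m))
          \<le> \<bar>\<gamma>\<^sub>0 m\<bar> * (C * X * S) + indicator T m * (R * S)" for m
      proof (cases "m \<in> T")
        case True
        \<comment> \<open>A total lag shorter than \<open>q\<close> forces \<open>m\<close> to undo
          most of \<open>k\<close>, hence \<open>\<bar>m\<bar> > k - q\<close>; evenness of
          \<open>\<gamma>\<^sub>0\<close> then covers negative \<open>m\<close>.\<close>
        then have "k - q < nat \<bar>m\<bar>" using b by (auto simp: T_def)
        from R[OF this] have "\<bar>\<gamma>\<^sub>0 m\<bar> \<le> R"
          using spectral_density_even[OF density0, of m] by (cases "0 \<le> m") auto
        moreover have "\<bar>toeplitz_form g b u v (int k + m)\<bar> \<le> S"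
          unfolding S_def by (rule toeplitz_form_le_sqrt[OF g])
        ultimately have "norm (\<gamma>\<^sub>0 m * toeplitz_form g b u v (int k + m)) \<le> R * S"
          using \<open>0 \<le> R\<close> by (simp add: abs_mult mult_mono)
        moreover have "0 \<le> \<bar>\<gamma>\<^sub>0 m\<bar> * (C * X * S)" using C X S by simp
        ultimately show ?thesis using True by simp
      next
        case False
        then have "int q \<le> \<bar>int k + m\<bar>" by (simp add: T_def)
        from decay[OF b(1,2) this, of u v] False show ?thesis
          by (simp add: abs_mult S_def X_def mult_left_mono)
      qed
      have iT: "integrable (count_space UNIV) (\<lambda>m. indicator T m * (R * S) :: real)"
        using T by (intro integrable_mult_left integrable_real_indicator)
          (auto simp: emeasure_count_space_finite of_nat_less_top)
      have LT: "(LINT m|count_space UNIV. indicator T m * (R * S)) = real (card T) * (R * S)"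
        using T by (simp add: measure_count_space)
      have bd: "norm (LINT m|count_space UNIV. \<gamma>\<^sub>0 m * toeplitz_form g b u v (int k + m))
          \<le> (LINT m|count_space UNIV. \<bar>\<gamma>\<^sub>0 m\<bar> * (C * X * S) + indicator T m * (R * S))"
      proof (rule order_trans[OF integral_norm_bound], rule Bochner_Integration.integral_mono)
        show "integrable (count_space UNIV) (\<lambda>m. \<bar>\<gamma>\<^sub>0 m\<bar> * (C * X * S) + indicator T m * (R * S))"
          by (intro Bochner_Integration.integrable_add integrable_mult_left integrable_abs sum iT)
      qed (rule integrable_norm[OF conv(1)] pt)+
      have "toeplitz_form \<gamma> b u v (int k)
          \<le> 1 / (2 * pi) * \<bar>LINT m|count_space UNIV. \<gamma>\<^sub>0 m * toeplitz_form g b u v (int k + m)\<bar>"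
        unfolding conv(2) by (intro mult_left_mono) auto
      also have "\<dots> \<le> 1 / (2 * pi) * (LINT m|count_space UNIV. \<bar>\<gamma>\<^sub>0 m\<bar> * (C * X * S) + indicator T m * (R * S))"
        by (rule mult_left_mono[OF bd[unfolded real_norm_def]]) simp
      also have "\<dots> = 1 / (2 * pi) * (A * (C * X * S) + real (card T) * (R * S))"
        using sum iT LT by (simp add: A_def)
      also have "\<dots> \<le> 1 / (2 * pi) * (A * (C * X * S) + 2 * real q * (R * S))"
        using T \<open>0 \<le> R\<close> S by (intro mult_left_mono add_left_mono mult_right_mono) auto
      also have "\<dots> = B * (c0 * S)" using c0 by (simp add: B_def field_simps)
      also have "\<dots> \<le> B * S'" by (rule mult_left_mono[OF SS' B])
      finally show "toeplitz_form \<gamma> b u v (int k)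
        \<le> B * (sqrt (toeplitz_form \<gamma> b u u 0) * sqrt (toeplitz_form \<gamma> b v v 0))"
        by (simp add: S'_def)
    qed
    also have "B = A * C / (2 * pi * c0) * X + 1 / (pi * c0) * real q * R"
      using c0 by (simp add: B_def field_simps)
    \<comment> \<open>The extra 1 makes the coefficient positive when only \<open>0 \<le> A\<close>
      is known.\<close>
    also have "\<dots> \<le> (A * C / (2 * pi * c0) + 1) * X + 1 / (pi * c0) * real q * R"
      using X by (simp add: distrib_right)
    finally show ?thesis by (simp add: X_def)
  qed
  show ?thesis
    by (rule that[OF _ _ main]) (use A C c0 in \<open>auto intro!: add_nonneg_pos\<close>)
qed

text \<open>The ratio of the two sequences is eventually bounded, hence bounded, so a larger
  constant absorbs the initial terms. Index 0 is excluded because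
  \<open>0 powr (- \<alpha>) = 0\<close>.\<close>

lemma bigo_global_bound:
  fixes f h :: "nat \<Rightarrow> real"
  assumes O: "f \<in> O(h)" and h: "\<And>n. 1 \<le> n \<Longrightarrow> 0 < h n"
  obtains A where "0 < A" "\<And>n. 1 \<le> n \<Longrightarrow> \<bar>f n\<bar> \<le> A * h n"
proof -
  obtain c where c: "0 < c" "eventually (\<lambda>n. norm (f n) \<le> c * norm (h n)) sequentially"
    using landau_o.bigE[OF O] by blast
  have "eventually (\<lambda>n. norm (f n / h n) \<le> c) sequentially"
    using c(2) eventually_ge_at_top[of 1]
  proof eventually_elim
    case (elim n)
    then show ?case using h[of n] by (simp add: pos_divide_le_eq)
  qed
  then have "Bseq (\<lambda>n. f n / h n)" by (rule BfunI)
  then obtain A where A: "0 < A" "\<And>n. norm (f n / h n) \<le> A" by (auto simp: Bseq_def)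
  have "\<bar>f n\<bar> \<le> A * h n" if "1 \<le> n" for n
    using A(2)[of n] h[OF that] by (simp add: pos_divide_le_eq)
  with A(1) show ?thesis by (rule that)
qed

theorem theorem3p2:
  fixes M :: "'a measure"
    and Z :: "int \<Rightarrow> 'a \<Rightarrow> real"
    and d :: real
    and f\<^sub>0 :: "real \<Rightarrow> real"
    and \<gamma>\<^sub>0 :: "int \<Rightarrow> real"
  assumes d: "0 < d" "d < 1 / 2"
    and prob: "prob_space M"
    and stationary: "second_order_stationary M Z"
    and nonsingular: "\<And>b. invertible_mat (block_covariance_matrix (covariance_function M Z) b)"
    and density: "spectral_density (\<lambda>x. fractional_density d x * f\<^sub>0 x) (covariance_function M Z)"
    and density0: "spectral_density f\<^sub>0 \<gamma>\<^sub>0"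
    and a: "(INF x\<in>{-pi<..pi}. f\<^sub>0 x) > 0"
    and b: "(\<lambda>n. \<bar>\<gamma>\<^sub>0 n\<bar>) summable_on UNIV"
  shows
    "(\<forall>\<alpha>>0. (\<lambda>n. \<gamma>\<^sub>0 (int n)) \<in> O(\<lambda>n. real n powr (- \<alpha>)) \<longrightarrow>
        (\<forall>\<epsilon>. 0 < \<epsilon> \<and> \<epsilon> < 1 \<longrightarrow>
          (\<exists>c\<^sub>1>0. \<exists>c\<^sub>2>0. \<forall>b k' k :: nat. 1 \<le> b \<and> b < k' \<and> real k' \<le> (1 - \<epsilon>) * real k \<longrightarrow>
             canonical_correlation M Z k b
               \<le> c\<^sub>1 * (real b / (real k' - real b)) powr (1 - 2 * d)
                 + c\<^sub>2 * real k' * real k powr (- \<alpha>))))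
     \<and> (\<forall>\<alpha>>0. (\<lambda>n. \<gamma>\<^sub>0 (int n)) \<in> o(\<lambda>n. real n powr (- \<alpha>)) \<longrightarrow>
        (\<forall>\<epsilon>. 0 < \<epsilon> \<and> \<epsilon> < 1 \<longrightarrow>
          (\<exists>c\<^sub>1>0. \<exists>c\<^sub>2>0. \<exists>r :: nat \<Rightarrow> real. r \<in> o(\<lambda>k. real k powr (- \<alpha>)) \<and>
            (\<forall>b k' k :: nat. 1 \<le> b \<and> b < k' \<and> real k' \<le> (1 - \<epsilon>) * real k \<longrightarrow>
             canonical_correlation M Z k b
               \<le> c\<^sub>1 * (real b / (real k' - real b)) powr (1 - 2 * d)
                 + c\<^sub>2 * real k' * r k))))
     \<and> (\<forall>c>0. (\<lambda>n. \<gamma>\<^sub>0 (int n)) \<in> O(\<lambda>n. exp (- c * real n)) \<longrightarrow>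
        (\<forall>\<epsilon>. 0 < \<epsilon> \<and> \<epsilon> < 1 \<longrightarrow>
          (\<exists>c\<^sub>1>0. \<exists>c\<^sub>2>0. \<exists>c\<^sub>3>0. \<forall>b k' k :: nat. 1 \<le> b \<and> b < k' \<and> real k' \<le> (1 - \<epsilon>) * real k \<longrightarrow>
             canonical_correlation M Z k b
               \<le> c\<^sub>1 * (real b / (real k' - real b)) powr (1 - 2 * d)
                 + c\<^sub>2 * exp (- c\<^sub>3 * real k))))"
proof -
  obtain c1 c2 where c1: "0 < c1" and c2: "0 < c2" and tail:
    "\<And>b q k R. 1 \<le> b \<Longrightarrow> b < q \<Longrightarrow> q < k \<Longrightarrow> (\<And>n. k - q < n \<Longrightarrow> \<bar>\<gamma>\<^sub>0 (int n)\<bar> \<le> R) \<Longrightarrow>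
      canonical_correlation M Z k b
        \<le> c1 * (real b / (real q - real b)) powr (1 - 2 * d) + c2 * real q * R"
    using canonical_correlation_tail_bound[OF d prob stationary density density0 a b] by blast
  \<comment> \<open>The hypothesis on \<open>q\<close> leaves a gap \<open>k - q\<close> of at least
    \<open>\<epsilon> * k\<close>, so every index beyond it is at least that large.\<close>
  have lag: "q < k \<and> 0 < k \<and> (\<forall>n. k - q < n \<longrightarrow> \<epsilon> * real k \<le> real n \<and> 1 \<le> n)"
    if "0 < \<epsilon>" "b < q" "real q \<le> (1 - \<epsilon>) * real k" for \<epsilon> :: real and b q k :: nat
  proof -
    have k: "0 < k" using that by (cases "k = 0") auto
    then have "0 < \<epsilon> * real k" using that by simp
    moreover have sum: "real q + \<epsilon> * real k \<le> real k" using that by (simp add: algebra_simps)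
    ultimately have "q < k" by linarith
    moreover have "\<epsilon> * real k \<le> real n" if "k - q < n" for n
    proof -
      have "real k < real n + real q" using that by linarith
      with sum show ?thesis by linarith
    qed
    ultimately show ?thesis using k by auto
  qed
  show ?thesis
  proof (intro conjI allI impI; elim conjE)

    \<comment> \<open>Polynomial decay, big-O\<close>
    fix \<alpha> \<epsilon> :: real
    assume \<alpha>: "0 < \<alpha>" and O: "(\<lambda>n. \<gamma>\<^sub>0 (int n)) \<in> O(\<lambda>n. real n powr (- \<alpha>))" and \<epsilon>: "0 < \<epsilon>" "\<epsilon> < 1"
    obtain A where A: "0 < A" "\<And>n. 1 \<le> n \<Longrightarrow> \<bar>\<gamma>\<^sub>0 (int n)\<bar> \<le> A * real n powr (- \<alpha>)"
      using bigo_global_bound[OF O] by auto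
    show "\<exists>c\<^sub>1>0. \<exists>c\<^sub>2>0. \<forall>b k' k :: nat. 1 \<le> b \<and> b < k' \<and> real k' \<le> (1 - \<epsilon>) * real k \<longrightarrow>
             canonical_correlation M Z k b
               \<le> c\<^sub>1 * (real b / (real k' - real b)) powr (1 - 2 * d)
                 + c\<^sub>2 * real k' * real k powr (- \<alpha>)"
    \<comment> \<open>The factor \<open>\<epsilon> powr (- \<alpha>)\<close> comes from evaluating
      the rate at \<open>\<epsilon> * k\<close>.\<close>
    proof (rule exI[of _ c1], intro conjI c1, rule exI[of _ "c2 * A * \<epsilon> powr (- \<alpha>)"], intro conjI allI impI)
      show "0 < c2 * A * \<epsilon> powr (- \<alpha>)" using c2 A \<epsilon> by simp
      fix b q k :: nat
      assume h: "1 \<le> b \<and> b < q \<and> real q \<le> (1 - \<epsilon>) * real k"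
      note l = lag[OF \<epsilon>(1), of b q k]
      have "canonical_correlation M Z k b \<le> c1 * (real b / (real q - real b)) powr (1 - 2 * d)
          + c2 * real q * (A * (\<epsilon> * real k) powr (- \<alpha>))"
      proof (rule tail)
        fix n assume n: "k - q < n"
        then have "\<bar>\<gamma>\<^sub>0 (int n)\<bar> \<le> A * real n powr (- \<alpha>)" using l h A(2) by auto
        also have "\<dots> \<le> A * (\<epsilon> * real k) powr (- \<alpha>)"
          using l h n A(1) \<alpha> \<epsilon> by (intro mult_left_mono powr_mono2') auto
        finally show "\<bar>\<gamma>\<^sub>0 (int n)\<bar> \<le> A * (\<epsilon> * real k) powr (- \<alpha>)" .
      qed (use h l in auto)
      then show "canonical_correlation M Z k b
               \<le> c1 * (real b / (real q - real b)) powr (1 - 2 * d)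
                 + c2 * A * \<epsilon> powr (- \<alpha>) * real q * real k powr (- \<alpha>)"
        using \<epsilon> by (simp add: powr_mult mult_ac)
    qed
  next

    \<comment> \<open>Polynomial decay, little-o\<close>
    fix \<alpha> \<epsilon> :: real
    assume \<alpha>: "0 < \<alpha>" and o: "(\<lambda>n. \<gamma>\<^sub>0 (int n)) \<in> o(\<lambda>n. real n powr (- \<alpha>))" and \<epsilon>: "0 < \<epsilon>" "\<epsilon> < 1"
    \<comment> \<open>The tail supremum bounds \<open>\<gamma>\<^sub>0\<close> at every index that
      the short lags involve, and it depends on \<open>k\<close> and \<open>\<epsilon>\<close> but
      not on the blocks; boundedness of \<open>\<gamma>\<^sub>0\<close> makes it finite.\<close>
    define r where "r k = (SUP n\<in>{n. \<epsilon> * real k \<le> real n}. \<bar>\<gamma>\<^sub>0 (int n)\<bar>)" for k :: nat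
    have bdd: "bdd_above ((\<lambda>n. \<bar>\<gamma>\<^sub>0 (int n)\<bar>) ` N)" for N
      using spectral_density_abs_le[OF density0] by (intro bdd_aboveI2)
    have ub: "\<bar>\<gamma>\<^sub>0 (int n)\<bar> \<le> r k" if "\<epsilon> * real k \<le> real n" for n k
      unfolding r_def using that by (intro cSUP_upper bdd) simp
    have r0: "0 \<le> r k" for k
      using ub[of k "nat \<lceil>\<epsilon> * real k\<rceil>"] abs_ge_zero order_trans of_nat_ceiling by blast
    have ro: "r \<in> o(\<lambda>k. real k powr (- \<alpha>))"
    proof (rule landau_o.smallI)
      fix c :: real assume c: "0 < c"
      \<comment> \<open>The factor \<open>\<epsilon> powr \<alpha>\<close> is chosen to cancel the
        one lost by passing from \<open>k\<close> to \<open>\<epsilon> * k\<close>.\<close>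
      have "eventually (\<lambda>n. norm (\<gamma>\<^sub>0 (int n)) \<le> c * \<epsilon> powr \<alpha> * norm (real n powr (- \<alpha>))) sequentially"
        by (rule landau_o.smallD[OF o]) (use c \<epsilon> in simp)
      then obtain N where N: "\<And>n. N \<le> n \<Longrightarrow> \<bar>\<gamma>\<^sub>0 (int n)\<bar> \<le> c * \<epsilon> powr \<alpha> * real n powr (- \<alpha>)"
        by (auto simp: eventually_sequentially)
      have "eventually (\<lambda>k. real N / \<epsilon> \<le> real k) sequentially"
        by (rule eventually_ge_at_top[THEN filterlim_real_sequentially[THEN filterlim_iff[THEN iffD1], rule_format]])
      then show "eventually (\<lambda>k. norm (r k) \<le> c * norm (real k powr (- \<alpha>))) sequentially"
        using eventually_ge_at_top[of 1]
      proof eventually_elim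
        case (elim k)
        have Nk: "real N \<le> \<epsilon> * real k" and pos: "0 < \<epsilon> * real k"
          using elim \<epsilon> by (simp_all add: pos_divide_le_eq mult.commute)
        have "r k \<le> c * real k powr (- \<alpha>)"
          unfolding r_def
        proof (rule cSUP_least)
          show "{n. \<epsilon> * real k \<le> real n} \<noteq> {}" using of_nat_ceiling by blast
          fix n assume "n \<in> {n. \<epsilon> * real k \<le> real n}"
          then have n: "\<epsilon> * real k \<le> real n" by simp
          with Nk have "N \<le> n" by linarith
          from N[OF this] have "\<bar>\<gamma>\<^sub>0 (int n)\<bar> \<le> c * \<epsilon> powr \<alpha> * real n powr (- \<alpha>)" .
          also have "\<dots> \<le> c * \<epsilon> powr \<alpha> * (\<epsilon> * real k) powr (- \<alpha>)"
            using c \<alpha> n pos by (intro mult_left_mono powr_mono2') auto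
          also have "\<dots> = c * real k powr (- \<alpha>)"
            using \<epsilon> by (simp add: powr_mult powr_minus)
          finally show "\<bar>\<gamma>\<^sub>0 (int n)\<bar> \<le> c * real k powr (- \<alpha>)" .
        qed
        then show ?case using r0[of k] by simp
      qed
    qed
    show "\<exists>c\<^sub>1>0. \<exists>c\<^sub>2>0. \<exists>r :: nat \<Rightarrow> real. r \<in> o(\<lambda>k. real k powr (- \<alpha>)) \<and>
            (\<forall>b k' k :: nat. 1 \<le> b \<and> b < k' \<and> real k' \<le> (1 - \<epsilon>) * real k \<longrightarrow>
             canonical_correlation M Z k b
               \<le> c\<^sub>1 * (real b / (real k' - real b)) powr (1 - 2 * d)
                 + c\<^sub>2 * real k' * r k)"
    proof (rule exI[of _ c1], intro conjI c1, rule exI[of _ c2], intro conjI c2,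
        rule exI[of _ r], intro conjI ro allI impI)
      fix b q k :: nat
      assume h: "1 \<le> b \<and> b < q \<and> real q \<le> (1 - \<epsilon>) * real k"
      note l = lag[OF \<epsilon>(1), of b q k]
      show "canonical_correlation M Z k b
          \<le> c1 * (real b / (real q - real b)) powr (1 - 2 * d) + c2 * real q * r k"
        by (rule tail) (use h l ub in auto)
    qed
  next

    \<comment> \<open>Exponential decay\<close>
    fix c \<epsilon> :: real
    assume c: "0 < c" and O: "(\<lambda>n. \<gamma>\<^sub>0 (int n)) \<in> O(\<lambda>n. exp (- c * real n))" and \<epsilon>: "0 < \<epsilon>" "\<epsilon> < 1"
    obtain A where A: "0 < A" "\<And>n. 1 \<le> n \<Longrightarrow> \<bar>\<gamma>\<^sub>0 (int n)\<bar> \<le> A * exp (- c * real n)"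
      using bigo_global_bound[OF O] by auto
    \<comment> \<open>Half of the rate \<open>c * \<epsilon>\<close> is kept as the final exponent;
      the other half absorbs the factor \<open>q\<close>, which is at most
      \<open>exp (\<delta> * k) / \<delta>\<close>.\<close>
    define \<delta> where "\<delta> = c * \<epsilon> / 2"
    have \<delta>: "0 < \<delta>" using c \<epsilon> by (simp add: \<delta>_def)
    have pos: "0 < c2 * A / \<delta>" using c2 A \<delta> by simp
    show "\<exists>c\<^sub>1>0. \<exists>c\<^sub>2>0. \<exists>c\<^sub>3>0. \<forall>b k' k :: nat. 1 \<le> b \<and> b < k' \<and> real k' \<le> (1 - \<epsilon>) * real k \<longrightarrow>
             canonical_correlation M Z k b
               \<le> c\<^sub>1 * (real b / (real k' - real b)) powr (1 - 2 * d)
                 + c\<^sub>2 * exp (- c\<^sub>3 * real k)"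
    proof (rule exI[of _ c1], rule conjI[OF c1], rule exI[of _ "c2 * A / \<delta>"], rule conjI[OF pos],
        rule exI[of _ \<delta>], rule conjI[OF \<delta>], intro allI impI)
      fix b q k :: nat
      assume h: "1 \<le> b \<and> b < q \<and> real q \<le> (1 - \<epsilon>) * real k"
      note l = lag[OF \<epsilon>(1), of b q k]
      have "canonical_correlation M Z k b \<le> c1 * (real b / (real q - real b)) powr (1 - 2 * d)
          + c2 * real q * (A * exp (- 2 * \<delta> * real k))"
      proof (rule tail)
        fix n assume n: "k - q < n"
        then have "\<bar>\<gamma>\<^sub>0 (int n)\<bar> \<le> A * exp (- c * real n)" using l h A(2) by auto
        also have "\<dots> \<le> A * exp (- 2 * \<delta> * real k)"
          using l h n A(1) c by (intro mult_left_mono) (auto simp: \<delta>_def)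
        finally show "\<bar>\<gamma>\<^sub>0 (int n)\<bar> \<le> A * exp (- 2 * \<delta> * real k)" .
      qed (use h l in auto)
      moreover have "real q * (A * exp (- 2 * \<delta> * real k)) \<le> A / \<delta> * exp (- \<delta> * real k)"
      proof -
        have "real q \<le> real k" using l h by auto
        also have "\<delta> * real k \<le> exp (\<delta> * real k)"
          using exp_ge_add_one_self[of "\<delta> * real k"] by linarith
        then have "real k \<le> exp (\<delta> * real k) / \<delta>" using \<delta> by (simp add: field_simps)
        finally have "real q * (A * exp (- 2 * \<delta> * real k))
            \<le> exp (\<delta> * real k) / \<delta> * (A * exp (- 2 * \<delta> * real k))"
          using A by (intro mult_right_mono) auto
        also have "exp (\<delta> * real k) / \<delta> * (A * exp (- 2 * \<delta> * real k))
            = A / \<delta> * (exp (\<delta> * real k) * exp (- 2 * \<delta> * real k))" by simp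
        also have "exp (\<delta> * real k) * exp (- 2 * \<delta> * real k) = exp (- \<delta> * real k)"
          by (simp add: exp_add[symmetric])
        finally show ?thesis .
      qed
      then have "c2 * (real q * (A * exp (- 2 * \<delta> * real k))) \<le> c2 * (A / \<delta> * exp (- \<delta> * real k))"
        using c2 by (intro mult_left_mono) auto
      ultimately show "canonical_correlation M Z k b
          \<le> c1 * (real b / (real q - real b)) powr (1 - 2 * d) + c2 * A / \<delta> * exp (- \<delta> * real k)"
        by (simp add: mult.assoc)
    qed
  qed
qed

end
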